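(* Let $k\ge1$ and $r\ge k$ be integers. Let $B_k$ be the graph on $\{c_1,\dots,c_{k+1}\}\sqcup\{z_1,\dots,z_{k-1}\}$ in which $\{c_1,\dots,c_{k+1}\}$ spans a clique, $\{z_1,\dots,z_{k-1}\}$ is an independent set (empty if $k=1$), and the neighborhood of $z_j$ is $\{c_1,\dots,c_j\}$ for each $1\le j\le k-1$. Let $G_{k,r}$ be the graph obtained from the disjoint union $B_k\sqcup K_{1,r}$ by adding a new vertex adjacent to every vertex of $B_k\sqcup K_{1,r}$, and let $n=|V(G_{k,r})|$ (so $n=2k+r+2$). Then $$n-3\ \ge\ \deg h_{R/J(G_{k,r})}(t)\ \ge\ \left\lceil\frac{2(n-2)}{3}\right\rceil.$$
   Context: $K_{1,r}$ is the star with $r$ leaves. $\Bbbk$ is a field and, for a graph $G$, $R=\Bbbk[x_v:v\in V(G)]$ with the standard grading. The cover ideal is $J(G)=\bigl(\prod_{v\in W}x_v : W \text{ a minimal vertex cover of } G\bigr)=\bigcap_{\{u,v\}\in E(G)}(x_u,x_v)$. For a standard graded $\Bbbk$-algebra $A$ with Hilbert series $H_A(t)$, the $h$-polynomial $h_A(t)\in\mathbb{Z}[t]$ is the unique polynomial with $H_A(t)=h_A(t)/(1-t)^{\dim A}$. *)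

theory Defs
  imports
    Complex_Main
    "HOL-Library.Poly_Mapping"
    "HOL-Library.Extended_Nat"
    "HOL-Computational_Algebra.Polynomial_FPS"
    "HOL-Algebra.QuotRing"
    "HOL-Algebra.Embedded_Algebras"
begin

section \<open>Graphs\<close>

record 'v sgraph =
  verts :: "'v set"
  edges :: "'v set set"

definition vertex_cover :: "'v sgraph \<Rightarrow> 'v set \<Rightarrow> bool" where
  "vertex_cover G W \<longleftrightarrow> W \<subseteq> verts G \<and> (\<forall>e\<in>edges G. e \<inter> W \<noteq> {})"

definition minimal_vertex_cover :: "'v sgraph \<Rightarrow> 'v set \<Rightarrow> bool" where
  "minimal_vertex_cover G W \<longleftrightarrow>
     vertex_cover G W \<and> (\<forall>W'. vertex_cover G W' \<longrightarrow> W' \<subseteq> W \<longrightarrow> W' = W)"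

definition disjoint_union :: "'v sgraph \<Rightarrow> 'w sgraph \<Rightarrow> ('v + 'w) sgraph" where
  "disjoint_union G H =
     \<lparr> verts = verts G <+> verts H,
       edges = (`) Inl ` edges G \<union> (`) Inr ` edges H \<rparr>"

text \<open>A new vertex \<open>None\<close> is made adjacent to every vertex.\<close>

definition cone :: "'v sgraph \<Rightarrow> 'v option sgraph" where
  "cone G =
     \<lparr> verts = insert None (Some ` verts G),
       edges = (`) Some ` edges G \<union> {{None, Some v} | v. v \<in> verts G} \<rparr>"

datatype star_vertex = Centre | Leaf nat

definition star :: "nat \<Rightarrow> star_vertex sgraph" where
  "star r =
     \<lparr> verts = insert Centre (Leaf ` {1..r}),
       edges = {{Centre, Leaf i} | i. i \<in> {1..r}} \<rparr>"

text \<open>\<open>CV i\<close> and \<open>ZV j\<close> stand for $c_i$ and $z_j$, with indices starting at 1.\<close>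

datatype B_vertex = CV nat | ZV nat

definition B_graph :: "nat \<Rightarrow> B_vertex sgraph" where
  "B_graph k =
     \<lparr> verts = CV ` {1..k + 1} \<union> ZV ` {1..k - 1},
       edges = {{CV i, CV j} | i j. i \<in> {1..k + 1} \<and> j \<in> {1..k + 1} \<and> i \<noteq> j}
             \<union> {{ZV j, CV i} | i j. j \<in> {1..k - 1} \<and> i \<in> {1..j}} \<rparr>"

definition G_graph :: "nat \<Rightarrow> nat \<Rightarrow> (B_vertex + star_vertex) option sgraph" where
  "G_graph k r = cone (disjoint_union (B_graph k) (star r))"

lemma card_verts_G_graph:
  assumes "k \<ge> 1"
  shows "card (verts (G_graph k r)) = 2 * k + r + 2"
proof -
  have "card (verts (B_graph k)) = (k + 1) + (k - 1)"
    unfolding B_graph_def sgraph.simps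
    by (subst card_Un_disjoint) (auto simp: card_image inj_on_def)
  moreover have "card (verts (star r)) = r + 1"
    unfolding star_def sgraph.simps
    by (subst card_insert_disjoint) (auto simp: card_image inj_on_def)
  moreover have "finite (verts (B_graph k))" "finite (verts (star r))"
    by (simp_all add: B_graph_def star_def)
  ultimately show ?thesis
    using assms
    by (simp add: G_graph_def cone_def disjoint_union_def card_image card_Plus)
qed


section \<open>Polynomial rings\<close>

text \<open>
  The ring $k[x_v : v \in V]$: monomials are exponent vectors \<open>'v \<Rightarrow>\<^sub>0 nat\<close>, and the carrier
  consists of the polynomials in which only variables indexed by \<open>V\<close> occur.
\<close>

definition poly_ring :: "'v set \<Rightarrow> (('v \<Rightarrow>\<^sub>0 nat) \<Rightarrow>\<^sub>0 'k::field) ring" where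
  "poly_ring V =
     \<lparr> carrier = {p. \<forall>m\<in>Poly_Mapping.keys p. Poly_Mapping.keys m \<subseteq> V},
       mult = (*), one = 1, zero = 0, add = (+) \<rparr>"

definition indet :: "'v \<Rightarrow> ('v \<Rightarrow>\<^sub>0 nat) \<Rightarrow>\<^sub>0 'k::field" where
  "indet v = Poly_Mapping.single (Poly_Mapping.single v 1) 1"

definition constants :: "(('v \<Rightarrow>\<^sub>0 nat) \<Rightarrow>\<^sub>0 'k::field) set" where
  "constants = {Poly_Mapping.single 0 c | c. True}"

definition homogeneous :: "'v set \<Rightarrow> nat \<Rightarrow> (('v \<Rightarrow>\<^sub>0 nat) \<Rightarrow>\<^sub>0 'k::field) set" where
  "homogeneous V d =
     {p \<in> carrier (poly_ring V).
        \<forall>m\<in>Poly_Mapping.keys p. (\<Sum>v\<in>Poly_Mapping.keys m. Poly_Mapping.lookup m v) = d}"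

lemma cring_poly_ring: "cring (poly_ring V :: (('v \<Rightarrow>\<^sub>0 nat) \<Rightarrow>\<^sub>0 'k::field) ring)"
proof -
  define M :: "('v \<Rightarrow>\<^sub>0 nat) set" where "M = {m. Poly_Mapping.keys m \<subseteq> V}"
  have M0: "0 \<in> M"
    by (simp add: M_def)
  have MD: "a + b \<in> M" if "a \<in> M" "b \<in> M" for a b
    using that Poly_Mapping.keys_add[of a b] by (auto simp: M_def)
  have car: "p \<in> carrier (poly_ring V) \<longleftrightarrow> Poly_Mapping.keys p \<subseteq> M"
    for p :: "('v \<Rightarrow>\<^sub>0 nat) \<Rightarrow>\<^sub>0 'k"
    by (auto simp: poly_ring_def M_def)
  have ops: "add (poly_ring V) = (+)" "mult (poly_ring V) = (*)"
      "zero (poly_ring V) = 0" "one (poly_ring V) = (1 :: ('v \<Rightarrow>\<^sub>0 nat) \<Rightarrow>\<^sub>0 'k)"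
    by (simp_all add: poly_ring_def)
  have closed_add: "Poly_Mapping.keys (p + q) \<subseteq> M"
    if "Poly_Mapping.keys p \<subseteq> M" "Poly_Mapping.keys q \<subseteq> M"
    for p q :: "('v \<Rightarrow>\<^sub>0 nat) \<Rightarrow>\<^sub>0 'k"
    using that Poly_Mapping.keys_add[of p q] by blast
  have closed_mult: "Poly_Mapping.keys (p * q) \<subseteq> M"
    if "Poly_Mapping.keys p \<subseteq> M" "Poly_Mapping.keys q \<subseteq> M"
    for p q :: "('v \<Rightarrow>\<^sub>0 nat) \<Rightarrow>\<^sub>0 'k"
    using that Poly_Mapping.keys_mult[of p q] MD by blast
  have closed_one: "Poly_Mapping.keys (1 :: ('v \<Rightarrow>\<^sub>0 nat) \<Rightarrow>\<^sub>0 'k) \<subseteq> M"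
    using M0 by simp
  show ?thesis
  proof (rule cringI)
    show "abelian_group (poly_ring V :: (('v \<Rightarrow>\<^sub>0 nat) \<Rightarrow>\<^sub>0 'k) ring)"
    proof (rule abelian_groupI, unfold car ops)
      fix p :: "('v \<Rightarrow>\<^sub>0 nat) \<Rightarrow>\<^sub>0 'k" assume "Poly_Mapping.keys p \<subseteq> M"
      then show "\<exists>q\<in>carrier (poly_ring V). q + p = 0"
        by (intro bexI[of _ "- p"]) (simp_all add: car)
    qed (simp_all add: closed_add add.assoc add.commute)
    show "comm_monoid (poly_ring V :: (('v \<Rightarrow>\<^sub>0 nat) \<Rightarrow>\<^sub>0 'k) ring)"
      by (rule comm_monoidI, unfold car ops)
         (simp_all only: closed_mult closed_one mult.assoc mult.commute mult.left_commute mult_1_left mult_1_right)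
  qed (simp add: ops distrib_right)
qed


section \<open>Hilbert series and h-polynomials\<close>

text \<open>Supremum of the lengths \<open>n\<close> of chains $P_0 \subset \cdots \subset P_n$ of prime ideals.\<close>

definition krull_dim :: "('a, 'b) ring_scheme \<Rightarrow> enat" where
  "krull_dim A =
     (SUP n \<in> {n. \<exists>P. (\<forall>i\<le>n. primeideal (P i) A) \<and> (\<forall>i<n. P i \<subset> P (Suc i))}. enat n)"

text \<open>
  A graded algebra is given by a ring \<open>A\<close>, the subfield \<open>K\<close> of scalars and the
  homogeneous components \<open>A\<^sub>i = gr i\<close>.
\<close>

definition hilbert_series ::
    "('a, 'b) ring_scheme \<Rightarrow> 'a set \<Rightarrow> (nat \<Rightarrow> 'a set) \<Rightarrow> int fps" where
  "hilbert_series A K gr = Abs_fps (\<lambda>i. int (ring.dim A K (gr i)))"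

text \<open>
  The equation $H_A(t) = h(t) / (1 - t)^{\dim A}$ is written without the quotient, because
  division of power series is only available over fields; $1 - t$ is a unit in
  $\mathbb{Z}[[t]]$.
\<close>

definition h_polynomial ::
    "('a, 'b) ring_scheme \<Rightarrow> 'a set \<Rightarrow> (nat \<Rightarrow> 'a set) \<Rightarrow> int poly" where
  "h_polynomial A K gr =
     (THE h. hilbert_series A K gr * (1 - fps_X) ^ the_enat (krull_dim A) = fps_of_poly h)"

text \<open>The h-polynomial of $R / J$ for a homogeneous ideal \<open>J\<close> of $R = k[x_v : v \in V]$.\<close>

definition quotient_h_polynomial ::
    "'v set \<Rightarrow> (('v \<Rightarrow>\<^sub>0 nat) \<Rightarrow>\<^sub>0 'k::field) set \<Rightarrow> int poly" where
  "quotient_h_polynomial V J =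
     h_polynomial (poly_ring V Quot J)
       ((\<lambda>p. J +>\<^bsub>poly_ring V\<^esub> p) ` constants)
       (\<lambda>i. (\<lambda>p. J +>\<^bsub>poly_ring V\<^esub> p) ` homogeneous V i)"


section \<open>Cover ideals\<close>

definition cover_ideal :: "'v sgraph \<Rightarrow> (('v \<Rightarrow>\<^sub>0 nat) \<Rightarrow>\<^sub>0 'k::field) set" where
  "cover_ideal G =
     Idl\<^bsub>poly_ring (verts G)\<^esub> {\<Prod>v\<in>W. indet v | W. minimal_vertex_cover G W}"

end

theory Submission
  imports Defs
begin

text \<open>
  Let \<open>G\<close> be a graph on \<open>n\<close> vertices with cover ideal \<open>J\<close>. A monomial lies in \<open>J\<close> exactly when its
  support is a vertex cover, so the remaining monomials form a basis of \<open>R/J\<close>. Sorted by their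
  support \<open>F\<close>, they contribute \<open>t\<^bsup>|F|\<^esup> / (1 - t)\<^bsup>|F|\<^esup>\<close> to the Hilbert series, and since the complements
  of the vertex covers are the independent sets,
  \<open>(1 - t)\<^bsup>n\<^esup> H(t) = 1 - I\<^sub>G(t, 1 - t)\<close> where \<open>I\<^sub>G(a, b)\<close> is the sum of \<open>a\<^bsup>n - |I|\<^esup> b\<^bsup>|I|\<^esup>\<close> over the
  independent sets \<open>I\<close>, the homogenized independence polynomial.

  This form is multiplicative on disjoint unions. Adding a vertex adjacent to all others turns
  \<open>I\<^sub>G\<close> into \<open>a I\<^sub>G + b a\<^bsup>n\<^esup>\<close>, and an edgeless graph has the form \<open>(a + b)\<^bsup>n\<^esup>\<close>, which is 1 on the line
  \<open>a + b = 1\<close>. There \<open>B\<^sub>k\<close> has the form \<open>2 t\<^bsup>k\<^esup> - t\<^bsup>2k\<^esup>\<close> and the star has \<open>t + (1 - t) t\<^bsup>r\<^esup>\<close>, whence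
  \<open>1 - I(t, 1 - t) = (1 - t\<^bsup>k+1\<^esup>)\<^sup>2 + 2 t\<^bsup>k+1\<^esup> (1 - t) (1 - t\<^bsup>r\<^esup>)\<close> for the graph of the theorem.

  The Krull dimension of \<open>R/J\<close> is \<open>n - 2\<close>. A prime over \<open>J\<close> contains both variables of some edge,
  and modulo these only \<open>n - 2\<close> variables remain. Elements picked from the successive
  differences of a chain of primes are algebraically independent, and counting monomials shows
  that \<open>n - 2\<close> variables do not leave room for \<open>n - 1\<close> algebraically independent polynomials.
  Conversely, the ideals generated by the variables of an edge and of more and more further
  vertices are a chain of primes over \<open>J\<close> of length \<open>n - 2\<close>.

  So \<open>h\<close> is the above expression divided by \<open>(1 - t)\<^sup>2\<close>, that is
  \<open>h = (1 + t + \<dots> + t\<^bsup>k\<^esup>)\<^sup>2 + 2 t\<^bsup>k+1\<^esup> (1 + t + \<dots> + t\<^bsup>r-1\<^esup>)\<close>. All coefficients are nonnegative and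
  \<open>r \<ge> k\<close>, so \<open>h\<close> has degree \<open>k + r\<close>. With \<open>n = 2 k + r + 2\<close> the two bounds say \<open>k \<ge> 1\<close> and \<open>r \<ge> k\<close>.
\<close>

section \<open>Monomials and squarefree monomial ideals\<close>

abbreviation keys :: "('a \<Rightarrow>\<^sub>0 'b::zero) \<Rightarrow> 'a set" where
  "keys \<equiv> Poly_Mapping.keys"

abbreviation lookup :: "('a \<Rightarrow>\<^sub>0 'b::zero) \<Rightarrow> 'a \<Rightarrow> 'b" where
  "lookup \<equiv> Poly_Mapping.lookup"

abbreviation single :: "'a \<Rightarrow> 'b \<Rightarrow> ('a \<Rightarrow>\<^sub>0 'b::zero)" where
  "single \<equiv> Poly_Mapping.single"

abbreviation total_degree :: "('v \<Rightarrow>\<^sub>0 nat) \<Rightarrow> nat" where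
  "total_degree m \<equiv> (\<Sum>v\<in>keys m. lookup m v)"

lemma carrier_poly_ring_iff:
  "p \<in> carrier (poly_ring V) \<longleftrightarrow> (\<forall>m\<in>keys p. keys m \<subseteq> V)"
  by (simp add: poly_ring_def)

lemma poly_ring_simps [simp]:
  "p \<oplus>\<^bsub>poly_ring V\<^esub> q = p + q" "p \<otimes>\<^bsub>poly_ring V\<^esub> q = p * q"
  "\<zero>\<^bsub>poly_ring V\<^esub> = 0" "\<one>\<^bsub>poly_ring V\<^esub> = 1"
  by (simp_all add: poly_ring_def)

lemma keys_add_nat: "keys (a + b) = keys a \<union> keys b" for a b :: "'v \<Rightarrow>\<^sub>0 nat"
  by (auto simp: in_keys_iff lookup_add)

lemma keys_mult_obtain:
  fixes p q :: "('v \<Rightarrow>\<^sub>0 nat) \<Rightarrow>\<^sub>0 'k::field"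
  assumes "m \<in> keys (p * q)"
  obtains a b where "a \<in> keys p" "b \<in> keys q" "m = a + b"
  using assms Poly_Mapping.keys_mult[of p q] by blast

lemma keys_sum_single:
  "keys (\<Sum>m\<in>A. single m (c m) :: 'a \<Rightarrow>\<^sub>0 'b::comm_monoid_add) \<subseteq> A"
proof (induction A rule: infinite_finite_induct)
  case (insert x F)
  then show ?case
    using Poly_Mapping.keys_add[of "single x (c x)" "\<Sum>m\<in>F. single m (c m)"]
    by (auto split: if_splits)
qed auto

lemma lookup_sum_single:
  assumes "finite A"
  shows "lookup (\<Sum>m\<in>A. single m (c m) :: 'a \<Rightarrow>\<^sub>0 'b::comm_monoid_add) x =
    (if x \<in> A then c x else 0)"
  using assms by (simp add: Poly_Mapping.lookup_sum lookup_single when_def sum.delta')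

lemma sum_single_keys: "(\<Sum>m\<in>keys p. single m (lookup p m)) = p"
  for p :: "'a \<Rightarrow>\<^sub>0 'b::comm_monoid_add"
  by (rule poly_mapping_eqI) (simp add: lookup_sum_single in_keys_iff)

lemma poly_ring_a_inv:
  assumes "p \<in> carrier (poly_ring V)"
  shows "\<ominus>\<^bsub>poly_ring V\<^esub> p = - p"
proof -
  interpret cring "poly_ring V :: (('a \<Rightarrow>\<^sub>0 nat) \<Rightarrow>\<^sub>0 'b) ring"
    by (rule cring_poly_ring)
  show ?thesis
    by (rule minus_equality) (use assms in \<open>auto simp: carrier_poly_ring_iff\<close>)
qed

lemma poly_ring_a_minus:
  assumes "q \<in> carrier (poly_ring V)"
  shows "p \<ominus>\<^bsub>poly_ring V\<^esub> q = p - q"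
  using assms by (simp add: a_minus_def poly_ring_a_inv)

text \<open>
  A squarefree monomial ideal is determined by the supports of its monomials, here described by a
  predicate \<open>U\<close> on sets of variables. Cover ideals arise from \<open>U = vertex_cover G\<close> and the ideals
  generated by a set \<open>S\<close> of variables from \<open>U A \<longleftrightarrow> A \<inter> S \<noteq> {}\<close>.
\<close>

definition mono_ideal ::
  "'v set \<Rightarrow> ('v set \<Rightarrow> bool) \<Rightarrow> (('v \<Rightarrow>\<^sub>0 nat) \<Rightarrow>\<^sub>0 'k::field) set" where
  "mono_ideal V U = {p \<in> carrier (poly_ring V). \<forall>m\<in>keys p. U (keys m)}"

definition up_closed :: "'v set \<Rightarrow> ('v set \<Rightarrow> bool) \<Rightarrow> bool" where
  "up_closed V U \<longleftrightarrow> (\<forall>A B. U A \<longrightarrow> A \<subseteq> B \<longrightarrow> B \<subseteq> V \<longrightarrow> U B)"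

lemma ideal_mono_ideal:
  fixes U :: "'v set \<Rightarrow> bool"
  assumes "up_closed V U"
  shows "ideal (mono_ideal V U) (poly_ring V :: (('v \<Rightarrow>\<^sub>0 nat) \<Rightarrow>\<^sub>0 'k::field) ring)"
proof -
  interpret R: cring "poly_ring V :: (('v \<Rightarrow>\<^sub>0 nat) \<Rightarrow>\<^sub>0 'k) ring"
    by (rule cring_poly_ring)
  have mult: "x * a \<in> mono_ideal V U"
    if "a \<in> mono_ideal V U" "x \<in> carrier (poly_ring V)"
    for a x :: "('v \<Rightarrow>\<^sub>0 nat) \<Rightarrow>\<^sub>0 'k"
  proof -
    have "x * a \<in> carrier (poly_ring V)"
      using R.m_closed[of x a] that by (simp add: mono_ideal_def)
    moreover have "U (keys m)" if m: "m \<in> keys (x * a)" for m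
    proof -
      from m obtain b c where bc: "b \<in> keys x" "c \<in> keys a" "m = b + c"
        by (rule keys_mult_obtain)
      then have "keys m \<subseteq> V" "U (keys c)" "keys c \<subseteq> keys m"
        using \<open>a \<in> _\<close> \<open>x \<in> _\<close> by (auto simp: mono_ideal_def carrier_poly_ring_iff keys_add_nat)
      then show ?thesis
        using assms unfolding up_closed_def by blast
    qed
    ultimately show ?thesis by (simp add: mono_ideal_def)
  qed
  show ?thesis
  proof (rule idealI)
    show "subgroup (mono_ideal V U) (add_monoid (poly_ring V :: (('v \<Rightarrow>\<^sub>0 nat) \<Rightarrow>\<^sub>0 'k) ring))"
    proof (rule R.add.subgroupI)
      show "mono_ideal V U \<subseteq> carrier (poly_ring V :: (('v \<Rightarrow>\<^sub>0 nat) \<Rightarrow>\<^sub>0 'k) ring)"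
        by (auto simp: mono_ideal_def)
      show "mono_ideal V U \<noteq> ({} :: (('v \<Rightarrow>\<^sub>0 nat) \<Rightarrow>\<^sub>0 'k) set)"
        by (auto simp: mono_ideal_def carrier_poly_ring_iff intro!: exI[of _ 0])
      show "\<ominus>\<^bsub>poly_ring V\<^esub> a \<in> mono_ideal V U" if "a \<in> mono_ideal V U"
        for a :: "('v \<Rightarrow>\<^sub>0 nat) \<Rightarrow>\<^sub>0 'k"
        using that poly_ring_a_inv[of a V] by (auto simp: mono_ideal_def carrier_poly_ring_iff)
      show "a \<oplus>\<^bsub>poly_ring V\<^esub> b \<in> mono_ideal V U"
        if "a \<in> mono_ideal V U" "b \<in> mono_ideal V U" for a b :: "('v \<Rightarrow>\<^sub>0 nat) \<Rightarrow>\<^sub>0 'k"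
        using that Poly_Mapping.keys_add[of a b]
        by (fastforce simp: mono_ideal_def carrier_poly_ring_iff)
    qed
  qed (use mult in \<open>auto simp: R.ring_axioms mult.commute\<close>)
qed

lemma prod_indet: "finite W \<Longrightarrow> (\<Prod>v\<in>W. indet v :: ('v \<Rightarrow>\<^sub>0 nat) \<Rightarrow>\<^sub>0 'k::field) =
    single (\<Sum>v\<in>W. single v 1) 1"
  by (induction W rule: finite_induct) (simp_all add: indet_def mult_single)

lemma keys_sum_indicator: "finite W \<Longrightarrow> keys (\<Sum>v\<in>W. single v (1::nat)) = W"
  by (auto simp: in_keys_iff lookup_sum_single split: if_splits)

lemma minimal_vertex_cover_exists:
  assumes "finite (verts G)" "vertex_cover G F"
  obtains W where "minimal_vertex_cover G W" "W \<subseteq> F"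
proof -
  have "finite F"
    using assms finite_subset unfolding vertex_cover_def by blast
  from finite_has_minimal2[of "{W. vertex_cover G W \<and> W \<subseteq> F}" F] this assms
  obtain W where W: "vertex_cover G W" "W \<subseteq> F"
      "\<And>W'. vertex_cover G W' \<Longrightarrow> W' \<subseteq> F \<Longrightarrow> W' \<subseteq> W \<Longrightarrow> W' = W"
    by (force simp: eq_commute)
  show ?thesis
    by (rule that[of W]) (use W in \<open>auto simp: minimal_vertex_cover_def\<close>)
qed

lemma up_closed_vertex_cover: "up_closed (verts G) (vertex_cover G)"
  by (fastforce simp: up_closed_def vertex_cover_def)


text \<open>
  A monomial whose support is a vertex cover is divisible by the generator of a minimal cover
  inside the support; conversely supports only grow under multiplication.
\<close>

lemma cover_ideal_eq_mono_ideal: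
  assumes fin: "finite (verts G)"
  shows "(cover_ideal G :: (('v \<Rightarrow>\<^sub>0 nat) \<Rightarrow>\<^sub>0 'k::field) set) = mono_ideal (verts G) (vertex_cover G)"
proof -
  let ?R = "poly_ring (verts G) :: (('v \<Rightarrow>\<^sub>0 nat) \<Rightarrow>\<^sub>0 'k) ring"
  let ?gens = "{\<Prod>v\<in>W. indet v | W. minimal_vertex_cover G W} :: (('v \<Rightarrow>\<^sub>0 nat) \<Rightarrow>\<^sub>0 'k) set"
  interpret R: cring ?R by (rule cring_poly_ring)
  have finW: "finite W" if "vertex_cover G W" for W
    using that fin finite_subset unfolding vertex_cover_def by blast
  have gens: "?gens \<subseteq> mono_ideal (verts G) (vertex_cover G)"
  proof clarify
    fix W assume "minimal_vertex_cover G W"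
    then have "vertex_cover G W" "W \<subseteq> verts G" "finite W"
      using finW by (auto simp: minimal_vertex_cover_def vertex_cover_def)
    then show "(\<Prod>v\<in>W. indet v) \<in> mono_ideal (verts G) (vertex_cover G)"
      by (simp add: prod_indet mono_ideal_def carrier_poly_ring_iff
          keys_sum_indicator[unfolded One_nat_def])
  qed
  have "mono_ideal (verts G) (vertex_cover G) \<subseteq> carrier ?R"
    by (auto simp: mono_ideal_def)
  with gens have gens_carrier: "?gens \<subseteq> carrier ?R"
    by (rule subset_trans)
  interpret J: ideal "cover_ideal G" ?R
    unfolding cover_ideal_def by (rule R.genideal_ideal) (rule gens_carrier)
  have "cover_ideal G \<subseteq> (mono_ideal (verts G) (vertex_cover G) :: (('v \<Rightarrow>\<^sub>0 nat) \<Rightarrow>\<^sub>0 'k) set)"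
    unfolding cover_ideal_def
    by (rule R.genideal_minimal[OF ideal_mono_ideal[OF up_closed_vertex_cover] gens])
  moreover have "p \<in> cover_ideal G" if p: "p \<in> mono_ideal (verts G) (vertex_cover G)"
    for p :: "('v \<Rightarrow>\<^sub>0 nat) \<Rightarrow>\<^sub>0 'k"
  proof -
    have monomial: "single m c \<in> cover_ideal G" if m: "vertex_cover G (keys m)" for m and c :: 'k
    proof -
      obtain W where W: "minimal_vertex_cover G W" "W \<subseteq> keys m"
        using minimal_vertex_cover_exists[OF fin m] .
      then have "finite W" "keys m \<subseteq> verts G"
        using m finite_subset[OF W(2) finite_keys] by (auto simp: vertex_cover_def)
      define w where "w = (\<Sum>v\<in>W. single v (1::nat))"
      have lw: "lookup w x = (if x \<in> W then 1 else 0)" for x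
        unfolding w_def using \<open>finite W\<close> by (rule lookup_sum_single)
      have "(m - w) + w = m"
      proof (rule poly_mapping_eqI)
        fix x
        have "x \<in> W \<Longrightarrow> lookup m x \<noteq> 0"
          using W(2) by (auto simp: in_keys_iff)
        then show "lookup (m - w + w) x = lookup m x"
          by (cases "x \<in> W") (simp_all add: lookup_add lookup_minus lw)
      qed
      moreover have "(\<Prod>v\<in>W. indet v) = (single w 1 :: ('v \<Rightarrow>\<^sub>0 nat) \<Rightarrow>\<^sub>0 'k)"
        using \<open>finite W\<close> by (simp add: prod_indet w_def)
      ultimately have eq: "single m c = single (m - w) c * (\<Prod>v\<in>W. indet v)"
        by (simp add: mult_single)
      have "keys (m - w) \<subseteq> verts G"
        using \<open>keys m \<subseteq> verts G\<close> by (force simp: in_keys_iff lookup_minus)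
      then have car: "single (m - w) c \<in> carrier ?R"
        by (cases "c = 0") (simp_all add: carrier_poly_ring_iff)
      have "(\<Prod>v\<in>W. indet v) \<in> ?gens"
        using W(1) by blast
      then have "(\<Prod>v\<in>W. indet v) \<in> (cover_ideal G :: (('v \<Rightarrow>\<^sub>0 nat) \<Rightarrow>\<^sub>0 'k) set)"
        unfolding cover_ideal_def using R.genideal_self[OF gens_carrier] by (rule rev_subsetD)
      from J.I_l_closed[OF this car] show ?thesis
        by (simp only: poly_ring_simps eq)
    qed
    have "(\<Sum>m\<in>A. single m (lookup p m)) \<in> cover_ideal G" if "A \<subseteq> keys p" for A
      using finite_subset[OF that finite_keys] that
    proof (induction A rule: finite_induct)
      case empty
      show ?case using J.zero_closed by simp
    next
      case (insert m A)
      then show ?case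
        using p monomial[of m] J.a_closed[of "single m (lookup p m)" "\<Sum>m\<in>A. single m (lookup p m)"]
        by (auto simp: mono_ideal_def)
    qed
    from this[of "keys p"] show ?thesis
      by (simp add: sum_single_keys)
  qed
  ultimately show ?thesis by blast
qed

section \<open>Monomials of bounded exponents and of given degree\<close>

text \<open>
  Boxes replace bounds on the total degree when counting monomials: they have the crude size
  estimate \<open>(b + 1)\<^bsup>|V|\<^esup>\<close>, which already separates the growth rates for different numbers of
  variables.
\<close>

definition box :: "'v set \<Rightarrow> nat \<Rightarrow> ('v \<Rightarrow>\<^sub>0 nat) set" where
  "box V b = {m. keys m \<subseteq> V \<and> (\<forall>v. lookup m v \<le> b)}"

lemma box_card:
  assumes "finite V"
  shows "finite (box V b)" "card (box V b) \<le> Suc b ^ card V"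
proof -
  let ?f = "\<lambda>m. restrict (lookup m) V"
  have inj: "inj_on ?f (box V b)"
  proof (rule inj_onI)
    fix m m' assume h: "m \<in> box V b" "m' \<in> box V b" "?f m = ?f m'"
    show "m = m'"
    proof (rule poly_mapping_eqI)
      fix v
      show "lookup m v = lookup m' v"
      proof (cases "v \<in> V")
        case True
        then show ?thesis using fun_cong[OF h(3), of v] by simp
      next
        case False
        then have "v \<notin> keys m" "v \<notin> keys m'"
          using h(1,2) by (auto simp: box_def)
        then show ?thesis by (simp add: in_keys_iff)
      qed
    qed
  qed
  have img: "?f ` box V b \<subseteq> (\<Pi>\<^sub>E v\<in>V. {..b})"
    by (auto simp: box_def)
  have fin: "finite (\<Pi>\<^sub>E v\<in>V. {..b})"
    using assms by (intro finite_PiE) auto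
  show "finite (box V b)"
    using finite_imageD[OF finite_subset[OF img fin] inj] .
  have "card (box V b) \<le> card (\<Pi>\<^sub>E v\<in>V. {..b})"
    by (rule card_inj_on_le[OF inj img fin])
  also have "\<dots> = Suc b ^ card V"
    using assms by (simp add: card_PiE)
  finally show "card (box V b) \<le> Suc b ^ card V" .
qed

lemma total_degree_eq_sum:
  fixes m :: "'v \<Rightarrow>\<^sub>0 nat"
  assumes "finite V" "keys m \<subseteq> V"
  shows "total_degree m = (\<Sum>v\<in>V. lookup m v)"
  using assms by (intro sum.mono_neutral_left) (auto simp: in_keys_iff)

lemma total_degree_add:
  fixes m m' :: "'v \<Rightarrow>\<^sub>0 nat"
  shows "total_degree (m + m') = total_degree m + total_degree m'"
proof -
  let ?V = "keys m \<union> keys m'"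
  have "total_degree (m + m') = (\<Sum>v\<in>?V. lookup m v) + (\<Sum>v\<in>?V. lookup m' v)"
    by (simp add: keys_add_nat lookup_add sum.distrib)
  then show ?thesis
    using total_degree_eq_sum[of ?V m] total_degree_eq_sum[of ?V m'] by simp
qed

lemma finite_monomials_of_degree:
  assumes "finite V"
  shows "finite {m :: 'v \<Rightarrow>\<^sub>0 nat. keys m \<subseteq> V \<and> total_degree m = i}" (is "finite ?M")
proof -
  have "lookup m v \<le> i" if "m \<in> ?M" for m v
    using that member_le_sum[of v "keys m" "lookup m"] by (cases "v \<in> keys m") (auto simp: in_keys_iff)
  then have "?M \<subseteq> box V i"
    by (auto simp: box_def)
  then show ?thesis
    using box_card(1)[OF assms] finite_subset by blast
qed

lemma box_mult:
  fixes p q :: "('v \<Rightarrow>\<^sub>0 nat) \<Rightarrow>\<^sub>0 'k::field"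
  assumes "keys p \<subseteq> box V b" "keys q \<subseteq> box V b'"
  shows "keys (p * q) \<subseteq> box V (b + b')"
proof
  fix m assume "m \<in> keys (p * q)"
  then obtain x y where "x \<in> keys p" "y \<in> keys q" "m = x + y"
    by (rule keys_mult_obtain)
  then show "m \<in> box V (b + b')"
    using assms by (fastforce simp: box_def keys_add_nat lookup_add intro: add_mono)
qed

lemma box_one: "keys (1 :: ('v \<Rightarrow>\<^sub>0 nat) \<Rightarrow>\<^sub>0 'k::field) \<subseteq> box V 0"
  by (simp add: box_def)

lemma box_power:
  fixes p :: "('v \<Rightarrow>\<^sub>0 nat) \<Rightarrow>\<^sub>0 'k::field"
  assumes "keys p \<subseteq> box V b"
  shows "keys (p ^ n) \<subseteq> box V (n * b)"
proof (induction n)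
  case (Suc n)
  show ?case
    using box_mult[OF assms Suc] by simp
qed (use box_one in simp)

lemma box_prod:
  fixes f :: "'i \<Rightarrow> ('v \<Rightarrow>\<^sub>0 nat) \<Rightarrow>\<^sub>0 'k::field"
  assumes "finite I" "\<And>i. i \<in> I \<Longrightarrow> keys (f i) \<subseteq> box V b"
  shows "keys (prod f I) \<subseteq> box V (card I * b)"
  using assms
proof (induction I rule: finite_induct)
  case (insert i F)
  then show ?case
    using box_mult[of "f i" V b "prod f F" "card F * b"] by simp
qed (use box_one in simp)

lemma box_mono: "b \<le> b' \<Longrightarrow> box V b \<subseteq> box V b'"
  by (auto simp: box_def intro: order_trans)

lemma keys_subset_box:
  fixes p :: "('v \<Rightarrow>\<^sub>0 nat) \<Rightarrow>\<^sub>0 'k::field"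
  assumes "p \<in> carrier (poly_ring V)"
  shows "\<exists>b. keys p \<subseteq> box V b"
proof -
  define b where "b = (\<Sum>m\<in>keys p. \<Sum>v\<in>keys m. lookup m v)"
  have "lookup m v \<le> b" if "m \<in> keys p" for m v
  proof (cases "v \<in> keys m")
    case True
    then have "lookup m v \<le> total_degree m"
      by (intro member_le_sum) auto
    also have "\<dots> \<le> b"
      unfolding b_def using that by (intro member_le_sum) auto
    finally show ?thesis .
  qed (simp add: in_keys_iff)
  then show ?thesis
    using assms by (auto simp: box_def carrier_poly_ring_iff intro!: exI[of _ b])
qed

section \<open>Monomial primes and primes of a quotient\<close>

text \<open>
  If the product of two terms of \<open>p\<close> and \<open>q\<close> is matched by no other pair of terms, nothing can
  cancel against it. This is what makes leading terms multiplicative.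
\<close>

lemma lookup_mult_unique_factorisation:
  fixes p q :: "('v \<Rightarrow>\<^sub>0 nat) \<Rightarrow>\<^sub>0 'k::field"
  assumes "a0 \<in> keys p" "b0 \<in> keys q"
    and uniq: "\<And>a b. a \<in> keys p \<Longrightarrow> b \<in> keys q \<Longrightarrow> a + b = a0 + b0 \<Longrightarrow> a = a0 \<and> b = b0"
  shows "lookup (p * q) (a0 + b0) = lookup p a0 * lookup q b0"
proof -
  have "p * q = (\<Sum>a\<in>keys p. single a (lookup p a)) * (\<Sum>b\<in>keys q. single b (lookup q b))"
    by (simp add: sum_single_keys)
  also have "\<dots> = (\<Sum>a\<in>keys p. \<Sum>b\<in>keys q. single (a + b) (lookup p a * lookup q b))"
    by (simp add: sum_product mult_single)
  finally have "lookup (p * q) (a0 + b0) =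
      (\<Sum>a\<in>keys p. \<Sum>b\<in>keys q. if a + b = a0 + b0 then lookup p a * lookup q b else 0)"
    by (simp add: Poly_Mapping.lookup_sum lookup_single when_def)
  also have "\<dots> = (\<Sum>a\<in>keys p. if a = a0 then \<Sum>b\<in>keys q. if b = b0 then lookup p a * lookup q b else 0 else 0)"
  proof (rule sum.cong[OF refl])
    fix a assume a: "a \<in> keys p"
    show "(\<Sum>b\<in>keys q. if a + b = a0 + b0 then lookup p a * lookup q b else 0) =
        (if a = a0 then \<Sum>b\<in>keys q. if b = b0 then lookup p a * lookup q b else 0 else 0)"
    proof (cases "a = a0")
      case False
      then show ?thesis
        using uniq[OF a] by (intro trans[OF sum.neutral]) auto
    qed auto
  qed
  also have "\<dots> = lookup p a0 * lookup q b0"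
    using assms(1,2) by (simp add: sum.delta')
  finally show ?thesis .
qed

text \<open>
  The ideal is generated by the variables in \<open>S\<close>. If \<open>p\<close> and \<open>q\<close> both have terms without
  variables in \<open>S\<close>, then the product of the largest such terms survives in \<open>p * q\<close>. For the order,
  the finitely many variables are numbered by \<open>f\<close>, and \<open>\<phi>\<close> transports monomials to
  \<open>nat \<Rightarrow>\<^sub>0 nat\<close>, whose linear order is compatible with addition.
\<close>

lemma prime_mono_ideal_hits:
  assumes "finite V"
  shows "primeideal (mono_ideal V (\<lambda>A. A \<inter> S \<noteq> {}))
           (poly_ring V :: (('v \<Rightarrow>\<^sub>0 nat) \<Rightarrow>\<^sub>0 'k::field) ring)"
    (is "primeideal ?P ?R")
proof (rule primeidealI)
  show "ideal ?P ?R"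
    by (rule ideal_mono_ideal) (auto simp: up_closed_def)
  show "cring ?R" by (rule cring_poly_ring)
  have "1 \<in> carrier ?R" "1 \<notin> ?P"
    by (simp_all add: mono_ideal_def carrier_poly_ring_iff)
  then show "carrier ?R \<noteq> ?P" by blast
  obtain f :: "'v \<Rightarrow> nat" where f: "inj_on f V"
    using finite_imp_inj_to_nat_seg[OF assms] by blast
  define \<phi> :: "('v \<Rightarrow>\<^sub>0 nat) \<Rightarrow> (nat \<Rightarrow>\<^sub>0 nat)"
    where "\<phi> m = (\<Sum>v\<in>V. single (f v) (lookup m v))" for m
  have \<phi>_add: "\<phi> (a + b) = \<phi> a + \<phi> b" for a b
    by (simp add: \<phi>_def lookup_add single_add sum.distrib)
  have lookup_\<phi>: "lookup (\<phi> m) (f v) = lookup m v" if "v \<in> V" for m v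
  proof -
    have "lookup (\<phi> m) (f v) = (\<Sum>w\<in>V. if w = v then lookup m w else 0)"
      unfolding \<phi>_def Poly_Mapping.lookup_sum
      by (rule sum.cong) (use f that in \<open>auto simp: lookup_single when_def inj_on_def\<close>)
    then show ?thesis using assms that by simp
  qed
  have \<phi>_inj: "a = b" if "\<phi> a = \<phi> b" "keys a \<subseteq> V" "keys b \<subseteq> V" for a b
  proof (rule poly_mapping_eqI)
    fix v
    show "lookup a v = lookup b v"
    proof (cases "v \<in> V")
      case True
      then show ?thesis
        using lookup_\<phi>[of v a] lookup_\<phi>[of v b] that(1) by simp
    next
      case False
      then have "v \<notin> keys a" "v \<notin> keys b"
        using that(2,3) by auto
      then show ?thesis by (simp add: in_keys_iff)
    qed
  qed
  have extremal: "\<exists>a0\<in>A. \<forall>a\<in>A. \<phi> a \<le> \<phi> a0" if "finite A" "A \<noteq> {}" for A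
    using that Max_in[of "\<phi> ` A"] Max_ge[of "\<phi> ` A"] by fastforce
  fix p q assume pq: "p \<in> carrier ?R" "q \<in> carrier ?R" "p \<otimes>\<^bsub>?R\<^esub> q \<in> ?P"
  show "p \<in> ?P \<or> q \<in> ?P"
  proof (rule ccontr)
    assume neither: "\<not> (p \<in> ?P \<or> q \<in> ?P)"
    define A where "A = {m \<in> keys p. keys m \<inter> S = {}}"
    define B where "B = {m \<in> keys q. keys m \<inter> S = {}}"
    have "finite A" "finite B" "A \<noteq> {}" "B \<noteq> {}"
      using neither pq(1,2) by (auto simp: A_def B_def mono_ideal_def)
    then obtain a0 b0 where ab: "a0 \<in> A" "b0 \<in> B" "\<And>a. a \<in> A \<Longrightarrow> \<phi> a \<le> \<phi> a0"
        "\<And>b. b \<in> B \<Longrightarrow> \<phi> b \<le> \<phi> b0"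
      using extremal[of A] extremal[of B] by blast
    have "lookup (p * q) (a0 + b0) = lookup p a0 * lookup q b0"
    proof (rule lookup_mult_unique_factorisation)
      show "a0 \<in> keys p" "b0 \<in> keys q"
        using ab(1,2) by (auto simp: A_def B_def)
      fix a b assume h: "a \<in> keys p" "b \<in> keys q" "a + b = a0 + b0"
      have "keys a \<union> keys b = keys a0 \<union> keys b0"
        using arg_cong[OF h(3), of keys] by (simp only: keys_add_nat)
      then have "a \<in> A" "b \<in> B"
        using h ab(1,2) by (auto simp: A_def B_def)
      moreover have "\<phi> a + \<phi> b = \<phi> a0 + \<phi> b0"
        using h(3) by (metis \<phi>_add)
      ultimately have "\<phi> a = \<phi> a0" "\<phi> b = \<phi> b0"
        using ab(3)[of a] ab(4)[of b] add_mono[of "\<phi> a" "\<phi> a0" "\<phi> b" "\<phi> b0"]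
          add_less_le_mono[of "\<phi> a" "\<phi> a0" "\<phi> b" "\<phi> b0"]
          add_le_less_mono[of "\<phi> a" "\<phi> a0" "\<phi> b" "\<phi> b0"]
        by (metis order.order_iff_strict order.irrefl)+
      moreover have "keys a \<subseteq> V" "keys b \<subseteq> V" "keys a0 \<subseteq> V" "keys b0 \<subseteq> V"
        using pq(1,2) h(1,2) ab(1,2) by (auto simp: carrier_poly_ring_iff A_def B_def)
      ultimately show "a = a0 \<and> b = b0"
        using \<phi>_inj by blast
    qed
    also have "\<dots> \<noteq> 0"
      using ab(1,2) by (simp add: A_def B_def Poly_Mapping.lookup_not_eq_zero_eq_in_keys)
    finally have "a0 + b0 \<in> keys (p * q)"
      by (simp add: in_keys_iff)
    then have "keys (a0 + b0) \<inter> S \<noteq> {}"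
      using pq(3) by (simp add: mono_ideal_def)
    then show False
      using ab(1,2) by (auto simp: A_def B_def keys_add_nat)
  qed
qed

lemma (in ring) coset_in_image_iff:
  assumes "ideal J R" "ideal P R" "J \<subseteq> P" "a \<in> carrier R"
  shows "J +> a \<in> (+>) J ` P \<longleftrightarrow> a \<in> P"
proof
  assume "J +> a \<in> (+>) J ` P"
  then obtain p where p: "p \<in> P" "J +> a = J +> p" by blast
  have pc: "p \<in> carrier R"
    using p(1) assms(2) ideal.Icarr by metis
  have "a \<ominus> p \<in> P"
    using quotient_eq_iff_same_a_r_cos[OF assms(1) assms(4) pc] p(2) assms(3) by blast
  then have "(a \<ominus> p) \<oplus> p \<in> P"
    using additive_subgroup.a_closed[OF ideal.axioms(1)[OF assms(2)]] p(1) by blast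
  then show "a \<in> P"
    using assms(4) pc by (simp add: a_minus_def a_assoc l_neg)
qed auto

lemma (in cring) primeideal_quotient_image:
  assumes "ideal J R" "primeideal P R" "J \<subseteq> P"
  shows "primeideal ((+>) J ` P) (R Quot J)"
proof -
  interpret J: ideal J R by fact
  interpret P: primeideal P R by fact
  have carr: "carrier (R Quot J) = (+>) J ` carrier R"
    by (auto simp: FactRing_def A_RCOSETS_def')
  have mem: "J +> a \<in> (+>) J ` P \<longleftrightarrow> a \<in> P" if "a \<in> carrier R" for a
    using coset_in_image_iff[OF assms(1) P.is_ideal assms(3) that] .
  show ?thesis
  proof (rule primeidealI)
    show "ideal ((+>) J ` P) (R Quot J)"
      using ring_ideal_imp_quot_ideal[OF assms(1) P.is_ideal] .
    show "cring (R Quot J)"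
      by (rule J.quotient_is_cring[OF is_cring])
    obtain a where "a \<in> carrier R" "a \<notin> P"
      using P.I_notcarr P.a_subset by blast
    then have "J +> a \<in> carrier (R Quot J)" "J +> a \<notin> (+>) J ` P"
      by (simp_all add: carr mem)
    then show "carrier (R Quot J) \<noteq> (+>) J ` P"
      by metis
    fix x y assume xy: "x \<in> carrier (R Quot J)" "y \<in> carrier (R Quot J)"
      "x \<otimes>\<^bsub>R Quot J\<^esub> y \<in> (+>) J ` P"
    then obtain a b where ab: "a \<in> carrier R" "b \<in> carrier R" "x = J +> a" "y = J +> b"
      unfolding carr by blast
    then have "J +> (a \<otimes> b) \<in> (+>) J ` P"
      using xy(3) by (simp add: FactRing_def J.rcoset_mult_add)
    then have "a \<otimes> b \<in> P"
      using mem ab by simp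
    then show "x \<in> (+>) J ` P \<or> y \<in> (+>) J ` P"
      using P.I_prime[of a b] ab by blast
  qed
qed

section \<open>Algebraic independence along chains of primes\<close>

lemma poly_ring_add: "p \<in> carrier (poly_ring V) \<Longrightarrow> q \<in> carrier (poly_ring V) \<Longrightarrow> p + q \<in> carrier (poly_ring V)"
  for p :: "('v \<Rightarrow>\<^sub>0 nat) \<Rightarrow>\<^sub>0 'k::field"
  using Poly_Mapping.keys_add[of p q] by (auto simp: carrier_poly_ring_iff)

lemma poly_ring_mult: "p \<in> carrier (poly_ring V) \<Longrightarrow> q \<in> carrier (poly_ring V) \<Longrightarrow> p * q \<in> carrier (poly_ring V)"
  for p :: "('v \<Rightarrow>\<^sub>0 nat) \<Rightarrow>\<^sub>0 'k::field"
  using Poly_Mapping.keys_mult[of p q] by (fastforce simp: carrier_poly_ring_iff keys_add_nat)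

lemma poly_ring_single: "keys m \<subseteq> V \<Longrightarrow> single m c \<in> carrier (poly_ring V)"
  by (simp add: carrier_poly_ring_iff)

lemma poly_ring_zero_one:
  "0 \<in> carrier (poly_ring V)" "1 \<in> carrier (poly_ring V)"
  by (simp_all add: carrier_poly_ring_iff)

lemma poly_ring_power: "p \<in> carrier (poly_ring V) \<Longrightarrow> p ^ n \<in> carrier (poly_ring V)"
  for p :: "('v \<Rightarrow>\<^sub>0 nat) \<Rightarrow>\<^sub>0 'k::field"
  by (induction n) (auto intro: poly_ring_mult poly_ring_zero_one)

lemma poly_ring_prod: "(\<And>i. i \<in> I \<Longrightarrow> f i \<in> carrier (poly_ring V)) \<Longrightarrow> prod f I \<in> carrier (poly_ring V)"
  for f :: "'i \<Rightarrow> ('v \<Rightarrow>\<^sub>0 nat) \<Rightarrow>\<^sub>0 'k::field"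
  by (induction I rule: infinite_finite_induct) (auto intro: poly_ring_mult poly_ring_zero_one)

lemma poly_ring_sum: "(\<And>i. i \<in> I \<Longrightarrow> f i \<in> carrier (poly_ring V)) \<Longrightarrow> sum f I \<in> carrier (poly_ring V)"
  for f :: "'i \<Rightarrow> ('v \<Rightarrow>\<^sub>0 nat) \<Rightarrow>\<^sub>0 'k::field"
  by (induction I rule: infinite_finite_induct) (auto intro: poly_ring_add poly_ring_zero_one)

lemmas poly_ring_closed =
  poly_ring_add poly_ring_mult poly_ring_single poly_ring_power poly_ring_prod poly_ring_sum

lemma ideal_poly_ring_add:
  assumes "ideal I (poly_ring V)" "p \<in> I" "q \<in> I"
  shows "p + q \<in> I"
  using additive_subgroup.a_closed[OF ideal.axioms(1)[OF assms(1)] assms(2,3)] by simp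

lemma ideal_poly_ring_diff:
  assumes "ideal I (poly_ring V)" "p \<in> I" "q \<in> I"
  shows "p - q \<in> I"
proof -
  interpret ideal I "poly_ring V" by fact
  have "- q \<in> I"
    using additive_subgroup.a_inv_closed[OF is_additive_subgroup assms(3)] poly_ring_a_inv[OF a_Hcarr[OF assms(3)]] by simp
  from ideal_poly_ring_add[OF assms(1,2) this] show ?thesis by simp
qed

lemma ideal_poly_ring_mult:
  assumes "ideal I (poly_ring V)" "p \<in> I" "q \<in> carrier (poly_ring V)"
  shows "q * p \<in> I"
  using ideal.I_l_closed[OF assms] by simp

lemma ideal_poly_ring_sum:
  assumes "ideal I (poly_ring V)" "\<And>x. x \<in> A \<Longrightarrow> f x \<in> I"
  shows "sum f A \<in> I"
  using assms(2)
proof (induction A rule: infinite_finite_induct)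
  case (insert x F)
  then show ?case using ideal_poly_ring_add[OF assms(1)] by simp
qed (use additive_subgroup.zero_closed[OF ideal.axioms(1)[OF assms(1)]] in simp_all)

lemma primeideal_poly_ring_mult:
  assumes "primeideal P (poly_ring V)" "p * q \<in> P"
    "p \<in> carrier (poly_ring V)" "q \<in> carrier (poly_ring V)"
  shows "p \<in> P \<or> q \<in> P"
  using primeideal.I_prime[OF assms(1,3,4)] assms(2) by simp

lemma primeideal_poly_ring_one:
  assumes "primeideal P (poly_ring V)"
  shows "1 \<notin> P"
proof
  interpret primeideal P "poly_ring V" by fact
  assume "1 \<in> P"
  then have "P = carrier (poly_ring V)"
    using one_imp_carrier by simp
  then show False using I_notcarr by blast
qed

lemma primeideal_poly_ring_constant:
  assumes "primeideal P (poly_ring V)" "c \<noteq> 0"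
  shows "single 0 c \<notin> P"
proof
  assume "single 0 c \<in> P"
  then have "single 0 (1 / c) * single 0 c \<in> P"
    using ideal_poly_ring_mult[OF primeideal.axioms(1)[OF assms(1)]] poly_ring_single[of 0 V "1 / c"]
    by simp
  then show False
    using primeideal_poly_ring_one[OF assms(1)] assms(2) by (simp add: mult_single)
qed

lemma primeideal_poly_ring_power:
  assumes "primeideal P (poly_ring V)" "y ^ n * p \<in> P" "y \<notin> P"
    "y \<in> carrier (poly_ring V)" "p \<in> carrier (poly_ring V)"
  shows "p \<in> P"
  using assms(2)
proof (induction n)
  case (Suc n)
  then show ?case
    using primeideal_poly_ring_mult[OF assms(1), of y "y ^ n * p"] assms(3-5)
    by (simp add: poly_ring_closed mult.assoc)
qed simp

text \<open>
  Given a chain of primes \<open>Q\<^sub>0 \<subseteq> \<dots> \<subseteq> Q\<^sub>M\<close> and \<open>y\<^sub>i \<in> Q\<^sub>i\<^sub>+\<^sub>1 - Q\<^sub>i\<close>, the \<open>y\<^sub>i\<close> are algebraically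
  independent over the field, even modulo \<open>Q\<^sub>0\<close>; the argument is the one behind the
  Coquand-Lombardi characterization of Krull dimension. The induction goes down from \<open>M\<close> and
  claims that a nontrivial combination of monomials in \<open>y\<^sub>j, \<dots>, y\<^bsub>M-1\<^esub>\<close> is not in \<open>Q\<^sub>j\<close>. If it were,
  the lowest power of \<open>y\<^sub>j\<close> could be cancelled, as \<open>y\<^sub>j \<notin> Q\<^sub>j\<close>; the terms still divisible by \<open>y\<^sub>j\<close> are
  in \<open>Q\<^sub>j\<^sub>+\<^sub>1\<close>, so the other ones would add up to an element of \<open>Q\<^sub>j\<^sub>+\<^sub>1\<close> as well. The exponent vectors in \<open>S\<close> are
  functions on all of \<open>nat\<close>, of which only the values on \<open>{j..<M}\<close> enter, so they must differ there.
\<close>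

lemma prime_chain_algebraically_independent:
  fixes Q :: "nat \<Rightarrow> (('v \<Rightarrow>\<^sub>0 nat) \<Rightarrow>\<^sub>0 'k::field) set"
    and y :: "nat \<Rightarrow> ('v \<Rightarrow>\<^sub>0 nat) \<Rightarrow>\<^sub>0 'k"
  assumes prime: "\<And>i. i \<le> M \<Longrightarrow> primeideal (Q i) (poly_ring V)"
    and mono: "\<And>i. i < M \<Longrightarrow> Q i \<subseteq> Q (Suc i)"
    and y: "\<And>i. i < M \<Longrightarrow> y i \<in> Q (Suc i) \<and> y i \<notin> Q i"
    and "j \<le> M" "finite S" "S \<noteq> {}" "\<And>a. a \<in> S \<Longrightarrow> c a \<noteq> 0"
    and "inj_on (\<lambda>a. restrict a {j..<M}) (S :: (nat \<Rightarrow> nat) set)"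
  shows "(\<Sum>a\<in>S. single 0 (c a) * (\<Prod>i\<in>{j..<M}. y i ^ a i)) \<notin> Q j"
  using assms(4-)
proof (induction j arbitrary: S rule: inc_induct)
  case base
  have "a = b" if "a \<in> S" "b \<in> S" for a b
    using base that by (auto simp: inj_on_def)
  then obtain a where "S = {a}"
    using base(2) by blast
  then show ?case
    using primeideal_poly_ring_constant[OF prime[OF order_refl]] base by simp
next
  case (step j)
  have yc: "y i \<in> carrier (poly_ring V)" if "i < M" for i
    using y[OF that] prime[of "Suc i"] that ideal.Icarr[OF primeideal.axioms(1)] by (metis Suc_leI)
  define e where "e = Min ((\<lambda>a. a j) ` S)"
  have e_le: "e \<le> a j" if "a \<in> S" for a
    unfolding e_def using step.prems(1) that by simp
  define T where "T = {a \<in> S. a j = e}"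
  have "e \<in> (\<lambda>a. a j) ` S"
    unfolding e_def using step.prems(1,2) by (intro Min_in) auto
  then have "T \<noteq> {}" by (auto simp: T_def)
  define rest where "rest a = single 0 (c a) * (\<Prod>i\<in>{Suc j..<M}. y i ^ a i)" for a
  have rest_carrier: "rest a \<in> carrier (poly_ring V)" for a
    unfolding rest_def using yc by (intro poly_ring_closed) auto
  define low where "low = (\<Sum>a\<in>T. rest a)"
  \<comment> \<open>The terms with more than the minimal power of \<open>y j\<close>, after removing \<open>y j ^ (e + 1)\<close>.\<close>
  define high where "high = (\<Sum>a\<in>S - T. rest a * y j ^ (a j - Suc e))"
  have high_carrier: "high \<in> carrier (poly_ring V)"
    unfolding high_def using yc step.hyps by (intro poly_ring_closed rest_carrier) auto
  have low_carrier: "low \<in> carrier (poly_ring V)"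
    unfolding low_def by (intro poly_ring_closed rest_carrier)
  have split: "single 0 (c a) * (\<Prod>i\<in>{j..<M}. y i ^ a i) = rest a * y j ^ a j" for a
    using step.hyps by (simp add: rest_def prod.atLeast_Suc_lessThan mult_ac)
  have "(\<Sum>a\<in>S. rest a * y j ^ a j) =
      (\<Sum>a\<in>S - T. rest a * y j ^ a j) + (\<Sum>a\<in>T. rest a * y j ^ a j)"
    using step.prems(1) by (intro sum.subset_diff) (auto simp: T_def)
  also have "(\<Sum>a\<in>T. rest a * y j ^ a j) = y j ^ e * low"
    unfolding low_def sum_distrib_left by (rule sum.cong) (auto simp: T_def mult.commute)
  also have "(\<Sum>a\<in>S - T. rest a * y j ^ a j) = y j ^ e * (y j * high)"
    unfolding high_def sum_distrib_left
  proof (rule sum.cong[OF refl])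
    fix a assume "a \<in> S - T"
    then have "e < a j"
      using e_le[of a] by (auto simp: T_def)
    then obtain d where d: "a j = e + Suc d"
      using less_iff_Suc_add by auto
    show "rest a * y j ^ a j = y j ^ e * (y j * (rest a * y j ^ (a j - Suc e)))"
      unfolding d by (simp add: power_add mult_ac)
  qed
  finally have total: "(\<Sum>a\<in>S. single 0 (c a) * (\<Prod>i\<in>{j..<M}. y i ^ a i)) = y j ^ e * (y j * high + low)"
    unfolding split by (simp add: distrib_left)
  have "low \<notin> Q (Suc j)"
    unfolding low_def rest_def
  proof (rule step.IH)
    show "finite T" "T \<noteq> {}" "\<And>a. a \<in> T \<Longrightarrow> c a \<noteq> 0"
      using step.prems \<open>T \<noteq> {}\<close> by (auto simp: T_def)
    show "inj_on (\<lambda>a. restrict a {Suc j..<M}) T"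
    proof (rule inj_onI)
      fix a b assume ab: "a \<in> T" "b \<in> T" "restrict a {Suc j..<M} = restrict b {Suc j..<M}"
      have "a i = b i" if "i \<in> {j..<M}" for i
      proof (cases "i = j")
        case True
        then show ?thesis using ab(1,2) by (simp add: T_def)
      next
        case False
        then have "i \<in> {Suc j..<M}" using that by auto
        then show ?thesis using fun_cong[OF ab(3), of i] by simp
      qed
      then have "restrict a {j..<M} = restrict b {j..<M}"
        by (rule restrict_ext)
      moreover have "a \<in> S" "b \<in> S"
        using ab(1,2) by (simp_all add: T_def)
      ultimately show "a = b"
        by (rule inj_onD[OF step.prems(4)])
    qed
  qed
  show ?case
  proof
    have j: "j < M" "j \<le> M" using step.hyps by auto
    assume "(\<Sum>a\<in>S. single 0 (c a) * (\<Prod>i\<in>{j..<M}. y i ^ a i)) \<in> Q j"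
    then have "y j * high + low \<in> Q j"
      unfolding total using y[OF j(1)] yc[OF j(1)]
      by (intro primeideal_poly_ring_power[OF prime[OF j(2)], of "y j" e "y j * high + low"]
          poly_ring_closed high_carrier low_carrier) auto
    then have 1: "y j * high + low \<in> Q (Suc j)"
      using mono[OF j(1)] by blast
    have id: "ideal (Q (Suc j)) (poly_ring V)"
      using prime[of "Suc j"] j(1) by (simp add: primeideal.axioms(1))
    have "high * y j \<in> Q (Suc j)"
      using ideal_poly_ring_mult[OF id _ high_carrier] y[OF j(1)] by blast
    from ideal_poly_ring_diff[OF id 1 this] \<open>low \<notin> Q (Suc j)\<close> show False
      by (simp add: mult.commute)
  qed
qed

text \<open>
  More polynomials than available monomials are linearly dependent. The family \<open>f\<close> may have
  repetitions, which give a dependence at once.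
\<close>

lemma linear_dependence_by_counting:
  fixes f :: "'a \<Rightarrow> (('v \<Rightarrow>\<^sub>0 nat) \<Rightarrow>\<^sub>0 'k::field)"
  assumes fin: "finite A" "finite B" and f: "\<And>a. a \<in> A \<Longrightarrow> keys (f a) \<subseteq> B"
    and less: "card B < card A"
  obtains c where "\<exists>a\<in>A. c a \<noteq> 0" "(\<Sum>a\<in>A. single 0 (c a) * f a) = 0"
proof (cases "inj_on f A")
  case False
  then obtain a b where ab: "a \<in> A" "b \<in> A" "a \<noteq> b" "f a = f b"
    by (auto simp: inj_on_def)
  define c where "c x = (if x = a then 1 else if x = b then - 1 else 0 :: 'k)" for x
  have "(\<Sum>x\<in>A. single 0 (c x) * f x) = (\<Sum>x\<in>{a, b}. single 0 (c x) * f x)"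
    using ab fin by (intro sum.mono_neutral_right) (auto simp: c_def)
  also have "\<dots> = 0"
    using ab(3,4) by (simp add: c_def single_uminus)
  finally show ?thesis
    using ab(1) by (intro that[of c]) (auto simp: c_def)
next
  case True
  let ?scale = "\<lambda>(c::'k) (p::('v \<Rightarrow>\<^sub>0 nat) \<Rightarrow>\<^sub>0 'k). single 0 c * p"
  interpret vector_space ?scale
    by unfold_locales
      (simp_all add: distrib_left distrib_right single_add mult.assoc[symmetric] mult_single)
  let ?M = "(\<lambda>m. single m 1) ` B :: (('v \<Rightarrow>\<^sub>0 nat) \<Rightarrow>\<^sub>0 'k) set"
  have span: "f ` A \<subseteq> span ?M"
  proof
    fix p assume "p \<in> f ` A"
    then have "keys p \<subseteq> B" using f by auto
    have "p = (\<Sum>m\<in>keys p. ?scale (lookup p m) (single m 1))"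
      by (simp add: mult_single sum_single_keys)
    also have "\<dots> \<in> span ?M"
      using \<open>keys p \<subseteq> B\<close> by (intro span_sum span_scale span_base) auto
    finally show "p \<in> span ?M" .
  qed
  have "card (f ` A) > card ?M"
    using less card_image[OF True] card_image_le[OF fin(2), of "\<lambda>m. single m (1::'k)"] by simp
  then have "dependent (f ` A)"
    using independent_span_bound[OF _ _ span] fin by force
  then obtain u where u: "\<exists>v\<in>f ` A. u v \<noteq> 0" "(\<Sum>v\<in>f ` A. ?scale (u v) v) = 0"
    using dependent_finite[of "f ` A"] fin by auto
  show ?thesis
    by (rule that[of "u \<circ> f"]) (use u in \<open>auto simp: sum.reindex[OF True]\<close>)
qed

lemma mono_ideal_hits_subset:
  fixes P :: "(('v \<Rightarrow>\<^sub>0 nat) \<Rightarrow>\<^sub>0 'k::field) set"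
  assumes "ideal P (poly_ring V)" "\<And>v. v \<in> E \<Longrightarrow> indet v \<in> P"
  shows "mono_ideal V (\<lambda>A. A \<inter> E \<noteq> {}) \<subseteq> P"
proof
  fix p :: "('v \<Rightarrow>\<^sub>0 nat) \<Rightarrow>\<^sub>0 'k"
  assume p: "p \<in> mono_ideal V (\<lambda>A. A \<inter> E \<noteq> {})"
  have "single m (lookup p m) \<in> P" if "m \<in> keys p" for m
  proof -
    from that p have "keys m \<subseteq> V" "keys m \<inter> E \<noteq> {}"
      by (auto simp: mono_ideal_def carrier_poly_ring_iff)
    then obtain v where v: "v \<in> keys m" "v \<in> E" "keys m \<subseteq> V"
      by blast
    have "m - single v 1 + single v 1 = m"
      by (rule poly_mapping_eqI)
        (use v(1) in \<open>auto simp: lookup_add lookup_minus lookup_single when_def in_keys_iff\<close>)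
    then have "single m (lookup p m) = single (m - single v 1) (lookup p m) * indet v"
      by (simp add: indet_def mult_single)
    moreover have "keys (m - single v 1) \<subseteq> V"
      using v(3) by (force simp: in_keys_iff lookup_minus)
    ultimately show ?thesis
      using ideal_poly_ring_mult[OF assms(1) assms(2)[OF v(2)]] poly_ring_single by metis
  qed
  then have "(\<Sum>m\<in>keys p. single m (lookup p m)) \<in> P"
    by (rule ideal_poly_ring_sum[OF assms(1)])
  then show "p \<in> P" by (simp add: sum_single_keys)
qed

lemma split_polynomial:
  fixes p :: "'m \<Rightarrow>\<^sub>0 'k::ab_group_add"
  obtains q where "keys q \<subseteq> {m \<in> keys p. X m}" "keys (p - q) \<subseteq> {m \<in> keys p. \<not> X m}"
proof -
  define K where "K = {m \<in> keys p. X m}"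
  define q where "q = (\<Sum>m\<in>K. single m (lookup p m))"
  have "keys q \<subseteq> K"
    unfolding q_def by (rule keys_sum_single)
  have "p - q = (\<Sum>m\<in>keys p. single m (lookup p m)) - q"
    by (simp add: sum_single_keys)
  also have "\<dots> = (\<Sum>m\<in>keys p - K. single m (lookup p m))"
    unfolding q_def by (rule sum_diff[symmetric]) (auto simp: K_def)
  finally have "keys (p - q) \<subseteq> keys p - K"
    using keys_sum_single[of "lookup p" "keys p - K"] by simp
  then show ?thesis
    using \<open>keys q \<subseteq> K\<close> by (intro that[of q]) (auto simp: K_def)
qed

lemma eliminate_variables:
  fixes p :: "('v \<Rightarrow>\<^sub>0 nat) \<Rightarrow>\<^sub>0 'k::field"
  assumes "p \<in> carrier (poly_ring V)"
  obtains q where "q \<in> carrier (poly_ring (V - E))" "p - q \<in> mono_ideal V (\<lambda>A. A \<inter> E \<noteq> {})"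
proof -
  obtain q where q: "keys q \<subseteq> {m \<in> keys p. keys m \<inter> E = {}}"
      "keys (p - q) \<subseteq> {m \<in> keys p. keys m \<inter> E \<noteq> {}}"
    by (rule split_polynomial)
  show ?thesis
  proof (rule that[of q])
    show "q \<in> carrier (poly_ring (V - E))"
      using q(1) assms by (fastforce simp: carrier_poly_ring_iff)
    show "p - q \<in> mono_ideal V (\<lambda>A. A \<inter> E \<noteq> {})"
      using q(2) assms unfolding mono_ideal_def carrier_poly_ring_iff by blast
  qed
qed

text \<open>
  Suppose the chain is longer than the number \<open>d\<close> of variables outside \<open>E\<close>. Choose \<open>y\<^sub>i\<close> in
  \<open>Q\<^sub>i\<^sub>+\<^sub>1 - Q\<^sub>i\<close> for \<open>i \<le> d\<close>; since the variables in \<open>E\<close> lie in \<open>Q\<^sub>0\<close>, the \<open>y\<^sub>i\<close> may be taken free of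
  them. There are \<open>(N + 1)\<^bsup>d+1\<^esup>\<close> monomials in the \<open>y\<^sub>i\<close> with exponents at most \<open>N\<close>, but they involve
  only \<open>O(N\<^bsup>d\<^esup>)\<close> monomials in the \<open>d\<close> variables. So for large \<open>N\<close> they are linearly dependent,
  contradicting algebraic independence.
\<close>

lemma prime_chain_length_le:
  fixes Q :: "nat \<Rightarrow> (('v \<Rightarrow>\<^sub>0 nat) \<Rightarrow>\<^sub>0 'k::field) set"
  assumes "finite V"
    and prime: "\<And>i. i \<le> M \<Longrightarrow> primeideal (Q i) (poly_ring V)"
    and chain: "\<And>i. i < M \<Longrightarrow> Q i \<subset> Q (Suc i)"
    and E: "\<And>v. v \<in> E \<Longrightarrow> indet v \<in> Q 0"
  shows "M \<le> card (V - E)"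
proof (rule ccontr)
  define d where "d = card (V - E)"
  assume "\<not> M \<le> card (V - E)"
  then have dM: "Suc d \<le> M" by (simp add: d_def)
  have Q0: "Q 0 \<subseteq> Q i" if "i \<le> M" for i
    using that
  proof (induction i)
    case (Suc i)
    then show ?case using chain[of i] by auto
  qed simp
  have id: "ideal (Q i) (poly_ring V)" if "i \<le> M" for i
    using prime[OF that] by (rule primeideal.axioms(1))
  have "\<exists>y. y \<in> Q (Suc i) \<and> y \<notin> Q i \<and> y \<in> carrier (poly_ring (V - E))" if i: "i < Suc d" for i
  proof -
    from i dM have iM: "i < M" "Suc i \<le> M" "i \<le> M" by auto
    obtain p where p: "p \<in> Q (Suc i)" "p \<notin> Q i"
      using chain[OF iM(1)] by blast
    have "p \<in> carrier (poly_ring V)"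
      using ideal.Icarr[OF id[OF iM(2)] p(1)] .
    then obtain q where q: "q \<in> carrier (poly_ring (V - E))" "p - q \<in> mono_ideal V (\<lambda>A. A \<inter> E \<noteq> {})"
      by (rule eliminate_variables)
    have "p - q \<in> Q 0"
      using mono_ideal_hits_subset[OF id[of 0] E] q(2) by blast
    then have "p - q \<in> Q i" "p - q \<in> Q (Suc i)"
      using Q0 iM by blast+
    then have "q \<in> Q (Suc i)" "q \<notin> Q i"
      using ideal_poly_ring_diff[OF id[OF iM(2)] p(1), of "p - q"]
        ideal_poly_ring_add[OF id[OF iM(3)], of "p - q" q] p(2) by auto
    with q(1) show ?thesis by blast
  qed
  then obtain y where y: "\<And>i. i < Suc d \<Longrightarrow> y i \<in> Q (Suc i) \<and> y i \<notin> Q i"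
      "\<And>i. i < Suc d \<Longrightarrow> y i \<in> carrier (poly_ring (V - E))"
    by metis
  have "\<exists>D. \<forall>i<Suc d. keys (y i) \<subseteq> box (V - E) D"
  proof -
    obtain b where b: "\<And>i. i < Suc d \<Longrightarrow> keys (y i) \<subseteq> box (V - E) (b i)"
      using keys_subset_box[OF y(2)] by metis
    have "keys (y i) \<subseteq> box (V - E) (\<Sum>i<Suc d. b i)" if "i < Suc d" for i
      using b[OF that] box_mono[of "b i" "\<Sum>i<Suc d. b i"] that member_le_sum[of i "{..<Suc d}" b]
      by auto
    then show ?thesis by blast
  qed
  then obtain D0 where D0: "\<And>i. i < Suc d \<Longrightarrow> keys (y i) \<subseteq> box (V - E) D0"
    by blast
  define C where "C = Suc d * Suc D0"
  \<comment> \<open>Chosen such that \<open>(C (N + 1))\<^bsup>d\<^esup> = N (N + 1)\<^bsup>d\<^esup> < (N + 1)\<^bsup>d+1\<^esup>\<close>. The successor of \<open>D0\<close> in \<open>C\<close> ensures \<open>C \<ge> 1\<close>.\<close>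
  define N where "N = C ^ d"
  define A where "A = (\<Pi>\<^sub>E i\<in>{..<Suc d}. {..N})"
  define f where "f a = (\<Prod>i\<in>{0..<Suc d}. y i ^ a i)" for a :: "nat \<Rightarrow> nat"
  have finA: "finite A" and cardA: "card A = Suc N ^ Suc d"
    unfolding A_def by (auto intro: finite_PiE simp: card_PiE)
  have f_box: "keys (f a) \<subseteq> box (V - E) (C * N)" if "a \<in> A" for a
  proof -
    have "keys (y i ^ a i) \<subseteq> box (V - E) (N * Suc D0)" if i: "i \<in> {0..<Suc d}" for i
    proof -
      have "keys (y i ^ a i) \<subseteq> box (V - E) (a i * D0)"
        using box_power[OF D0] i by simp
      moreover have "a i * D0 \<le> N * Suc D0"
        using \<open>a \<in> A\<close> i by (intro mult_le_mono) (auto simp: A_def PiE_def Pi_def)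
      ultimately show ?thesis
        using box_mono by blast
    qed
    then have "keys (f a) \<subseteq> box (V - E) (card {0..<Suc d} * (N * Suc D0))"
      unfolding f_def by (intro box_prod) auto
    also have "card {0..<Suc d} * (N * Suc D0) = C * N"
      unfolding C_def by (simp only: card_atLeastLessThan minus_nat.diff_0 mult_ac)
    finally show ?thesis .
  qed
  have "card (box (V - E) (C * N)) \<le> Suc (C * N) ^ d"
    using box_card(2)[of "V - E" "C * N"] assms(1) by (simp add: d_def)
  also have "\<dots> \<le> (C * Suc N) ^ d"
    by (intro power_mono) (simp_all add: C_def)
  also have "\<dots> = N * Suc N ^ d"
    unfolding power_mult_distrib by (simp only: N_def)
  also have "\<dots> < card A"
    unfolding cardA by simp
  finally have fewer: "card (box (V - E) (C * N)) < card A" .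
  have "finite (box (V - E) (C * N))"
    using assms(1) by (simp add: box_card(1))
  from linear_dependence_by_counting[of A _ f, OF finA this f_box fewer]
  obtain c where c: "\<exists>a\<in>A. c a \<noteq> 0" "(\<Sum>a\<in>A. single 0 (c a) * f a) = 0"
    by metis
  define S where "S = {a \<in> A. c a \<noteq> 0}"
  have "(\<Sum>a\<in>S. single 0 (c a) * f a) \<notin> Q 0"
    unfolding f_def
  proof (rule prime_chain_algebraically_independent[where V = V])
    show "primeideal (Q i) (poly_ring V)" if "i \<le> Suc d" for i
      using prime that dM by simp
    show "Q i \<subseteq> Q (Suc i)" if "i < Suc d" for i
      using chain[of i] that dM by auto
    show "inj_on (\<lambda>a. restrict a {0..<Suc d}) S"
      by (rule inj_onI) (metis (no_types, lifting) A_def PiE_restrict S_def lessThan_atLeast0 mem_Collect_eq)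
  qed (use y(1) finA c(1) in \<open>auto simp: S_def\<close>)
  moreover have "(\<Sum>a\<in>S. single 0 (c a) * f a) = (\<Sum>a\<in>A. single 0 (c a) * f a)"
    using finA by (intro sum.mono_neutral_left) (auto simp: S_def)
  moreover have "0 \<in> Q 0"
    using additive_subgroup.zero_closed[OF ideal.axioms(1)[OF id[of 0]]] by simp
  ultimately show False
    using c(2) by simp
qed

section \<open>The Krull dimension of the quotient by a cover ideal\<close>

text \<open>
  Otherwise the variables outside \<open>P\<close> form a vertex cover, so their product is in \<open>J \<subseteq> P\<close>, although
  \<open>P\<close> is prime.
\<close>

lemma edge_in_prime_over_cover_ideal:
  fixes P :: "(('v \<Rightarrow>\<^sub>0 nat) \<Rightarrow>\<^sub>0 'k::field) set"
  assumes "finite (verts G)" "\<And>e. e \<in> edges G \<Longrightarrow> e \<subseteq> verts G"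
    and P: "primeideal P (poly_ring (verts G))" and sub: "cover_ideal G \<subseteq> P"
  obtains e where "e \<in> edges G" "\<And>v. v \<in> e \<Longrightarrow> indet v \<in> P"
proof (rule ccontr)
  assume "\<not> thesis"
  define W where "W = {v \<in> verts G. (indet v :: ('v \<Rightarrow>\<^sub>0 nat) \<Rightarrow>\<^sub>0 'k) \<notin> P}"
  have "finite W"
    using assms(1) by (simp add: W_def)
  have "vertex_cover G W"
    unfolding vertex_cover_def W_def using assms(2) that \<open>\<not> thesis\<close> by blast
  then have "(\<Prod>v\<in>W. indet v) \<in> (cover_ideal G :: (('v \<Rightarrow>\<^sub>0 nat) \<Rightarrow>\<^sub>0 'k) set)"
    unfolding cover_ideal_eq_mono_ideal[OF assms(1)] prod_indet[OF \<open>finite W\<close>] mono_ideal_def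
    by (simp add: carrier_poly_ring_iff keys_sum_indicator[OF \<open>finite W\<close>, unfolded One_nat_def]
        vertex_cover_def)
  then have "(\<Prod>v\<in>W. indet v) \<in> P"
    using sub by blast
  moreover have "(\<Prod>v\<in>W'. indet v) \<notin> P" if "W' \<subseteq> W" for W'
    using finite_subset[OF that \<open>finite W\<close>] that
  proof (induction W' rule: finite_induct)
    case empty
    then show ?case using primeideal_poly_ring_one[OF P] by simp
  next
    case (insert v W')
    have "indet u \<in> carrier (poly_ring (verts G))" if "u \<in> insert v W'" for u
      using insert.prems that by (auto simp: indet_def W_def intro!: poly_ring_single split: if_splits)
    then have "indet v \<in> carrier (poly_ring (verts G))"
        "(\<Prod>v\<in>W'. indet v) \<in> carrier (poly_ring (verts G))"
      by (auto intro: poly_ring_prod)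
    then show ?case
      using primeideal_poly_ring_mult[OF P, of "indet v" "\<Prod>v\<in>W'. indet v"] insert
      by (auto simp: W_def)
  qed
  ultimately show False by blast
qed

text \<open>
  For the upper bound, primes of the quotient are pulled back to the polynomial ring, where the
  smallest one contains the variables of an edge. For the lower bound, the variables outside an
  edge \<open>e\<close> are adjoined one at a time to the prime generated by those in \<open>e\<close>; this prime contains
  the cover ideal because every cover meets \<open>e\<close>.
\<close>

lemma krull_dim_cover_ideal:
  assumes fin: "finite (verts G)" and edge: "\<And>e. e \<in> edges G \<Longrightarrow> e \<subseteq> verts G \<and> card e = 2"
    and nonempty: "edges G \<noteq> {}"
  shows "krull_dim (poly_ring (verts G) Quot (cover_ideal G :: (('v \<Rightarrow>\<^sub>0 nat) \<Rightarrow>\<^sub>0 'k::field) set)) =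
    enat (card (verts G) - 2)"
proof -
  define V where "V = verts G"
  define J where "J = (cover_ideal G :: (('v \<Rightarrow>\<^sub>0 nat) \<Rightarrow>\<^sub>0 'k) set)"
  let ?R = "poly_ring V :: (('v \<Rightarrow>\<^sub>0 nat) \<Rightarrow>\<^sub>0 'k) ring"
  let ?A = "?R Quot J"
  have J: "J = mono_ideal V (vertex_cover G)"
    unfolding J_def V_def by (rule cover_ideal_eq_mono_ideal[OF fin])
  interpret R: cring ?R by (rule cring_poly_ring)
  interpret J: ideal J ?R
    unfolding J V_def by (rule ideal_mono_ideal[OF up_closed_vertex_cover])
  have finV: "finite V" using fin by (simp add: V_def)
  have card_minus_edge: "card (V - e) = card V - 2" if "e \<in> edges G" for e
    using edge[OF that] finV finite_subset by (subst card_Diff_subset) (auto simp: V_def)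
  have upper: "n \<le> card V - 2"
    if prime: "\<And>i. i \<le> n \<Longrightarrow> primeideal (P i) ?A" and chain: "\<And>i. i < n \<Longrightarrow> P i \<subset> P (Suc i)"
    for n P
  proof -
    define Q where "Q i = {p \<in> carrier ?R. J +>\<^bsub>?R\<^esub> p \<in> P i}" for i
    have Qprime: "primeideal (Q i) ?R" if "i \<le> n" for i
      unfolding Q_def
      by (rule ring_hom_ring.primeideal_vimage[OF J.rcos_ring_hom_ring cring_poly_ring prime[OF that]])
    have "J \<subseteq> Q 0"
    proof
      fix p assume p: "p \<in> J"
      have "J +>\<^bsub>?R\<^esub> p = \<zero>\<^bsub>?A\<^esub>"
        using R.a_rcos_zero[OF J.is_ideal p] by (simp add: FactRing_def)
      then have "J +>\<^bsub>?R\<^esub> p \<in> P 0"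
        using additive_subgroup.zero_closed[OF ideal.axioms(1)[OF primeideal.axioms(1)[OF prime[of 0]]]]
        by simp
      then show "p \<in> Q 0"
        using J.Icarr[OF p] by (simp add: Q_def)
    qed
    then obtain e where e: "e \<in> edges G" "\<And>v. v \<in> e \<Longrightarrow> indet v \<in> Q 0"
      using edge_in_prime_over_cover_ideal[of G "Q 0"] fin edge Qprime[of 0]
      unfolding J_def V_def by blast
    have "Q i \<subset> Q (Suc i)" if i: "i < n" for i
    proof -
      obtain x where x: "x \<in> P (Suc i)" "x \<notin> P i"
        using chain[OF i] by blast
      have "x \<in> carrier ?A"
        using ideal.Icarr[OF primeideal.axioms(1)[OF prime[of "Suc i"]] x(1)] i by simp
      then obtain p where "p \<in> carrier ?R" "x = J +>\<^bsub>?R\<^esub> p"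
        by (auto simp: FactRing_def A_RCOSETS_def')
      then have "p \<in> Q (Suc i)" "p \<notin> Q i"
        using x by (auto simp: Q_def)
      moreover have "Q i \<subseteq> Q (Suc i)"
        using chain[OF i] by (auto simp: Q_def)
      ultimately show ?thesis by blast
    qed
    from prime_chain_length_le[of V n Q e, OF finV Qprime this e(2)] show ?thesis
      using card_minus_edge[OF e(1)] by simp
  qed
  have lower: "\<exists>P. (\<forall>i\<le>card V - 2. primeideal (P i) ?A) \<and> (\<forall>i<card V - 2. P i \<subset> P (Suc i))"
  proof -
    obtain e where e: "e \<in> edges G" using nonempty by blast
    obtain xs where xs: "set xs = V - e" "distinct xs"
      using finite_distinct_list[of "V - e"] finV by blast
    then have len: "length xs = card V - 2"
      using distinct_card[OF xs(2)] card_minus_edge[OF e] by simp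
    define S where "S i = e \<union> set (take i xs)" for i
    define Q where "Q i = (mono_ideal V (\<lambda>A. A \<inter> S i \<noteq> {}) :: (('v \<Rightarrow>\<^sub>0 nat) \<Rightarrow>\<^sub>0 'k) set)" for i
    define P where "P i = (\<lambda>p. J +>\<^bsub>?R\<^esub> p) ` Q i" for i
    have prime: "primeideal (Q i) ?R" for i
      unfolding Q_def by (rule prime_mono_ideal_hits[OF finV])
    have JQ: "J \<subseteq> Q i" for i
      using e unfolding J Q_def S_def mono_ideal_def vertex_cover_def by blast
    have "P i \<subset> P (Suc i)" if i: "i < card V - 2" for i
    proof -
      have x: "xs ! i \<in> V" "xs ! i \<notin> S i" "xs ! i \<in> S (Suc i)"
        using i len xs nth_mem[of i xs]
        by (auto simp: S_def in_set_conv_nth nth_eq_iff_index_eq take_Suc_conv_app_nth)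
      then have "indet (xs ! i) \<in> Q (Suc i)" "indet (xs ! i) \<notin> Q i" "indet (xs ! i) \<in> carrier ?R"
        by (auto simp: Q_def mono_ideal_def indet_def carrier_poly_ring_iff)
      then have "J +>\<^bsub>?R\<^esub> indet (xs ! i) \<in> P (Suc i)" "J +>\<^bsub>?R\<^esub> indet (xs ! i) \<notin> P i"
        using R.coset_in_image_iff[OF J.is_ideal primeideal.axioms(1)[OF prime] JQ]
        by (simp_all add: P_def)
      moreover have "S i \<subseteq> S (Suc i)"
        using set_take_subset_set_take[of i "Suc i" xs] by (auto simp: S_def)
      then have "P i \<subseteq> P (Suc i)"
        unfolding P_def Q_def mono_ideal_def by (intro image_mono) blast
      ultimately show ?thesis by blast
    qed
    moreover have "primeideal (P i) ?A" for i
      unfolding P_def by (rule R.primeideal_quotient_image[OF J.is_ideal prime JQ])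
    ultimately show ?thesis by blast
  qed
  have "krull_dim ?A = enat (card V - 2)"
    unfolding krull_dim_def
  proof (rule antisym)
    show "(SUP n \<in> {n. \<exists>P. (\<forall>i\<le>n. primeideal (P i) ?A) \<and> (\<forall>i<n. P i \<subset> P (Suc i))}. enat n)
        \<le> enat (card V - 2)"
      using upper by (intro SUP_least) auto
    show "enat (card V - 2) \<le>
        (SUP n \<in> {n. \<exists>P. (\<forall>i\<le>n. primeideal (P i) ?A) \<and> (\<forall>i<n. P i \<subset> P (Suc i))}. enat n)"
      using lower by (intro SUP_upper) simp
  qed
  then show ?thesis by (simp add: V_def J_def)
qed

section \<open>The Hilbert series of the quotient by a squarefree monomial ideal\<close>

lemma homogeneous_iff:
  "p \<in> homogeneous V d \<longleftrightarrow>
    (\<forall>m\<in>keys p. keys m \<subseteq> V \<and> total_degree m = d)"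
  by (auto simp: homogeneous_def carrier_poly_ring_iff)

lemma subfield_constants:
  "subfield constants (poly_ring V :: (('v \<Rightarrow>\<^sub>0 nat) \<Rightarrow>\<^sub>0 'k::field) ring)"
proof -
  let ?R = "poly_ring V :: (('v \<Rightarrow>\<^sub>0 nat) \<Rightarrow>\<^sub>0 'k) ring"
  let ?K = "constants :: (('v \<Rightarrow>\<^sub>0 nat) \<Rightarrow>\<^sub>0 'k) set"
  interpret R: cring ?R by (rule cring_poly_ring)
  have K: "?K \<subseteq> carrier ?R"
    by (auto simp: constants_def carrier_poly_ring_iff)
  show ?thesis
  proof (rule R.subfieldI)
    show "subcring ?K ?R"
    proof (rule R.subcringI', rule R.subringI)
      show "?K \<subseteq> carrier ?R" by (rule K)
      show "\<one>\<^bsub>?R\<^esub> \<in> ?K"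
        by (auto simp: constants_def intro!: exI[of _ 1])
      fix h h' assume h: "h \<in> ?K" "h' \<in> ?K"
      then obtain c c' where c: "h = single 0 c" "h' = single 0 c'"
        by (auto simp: constants_def)
      show "\<ominus>\<^bsub>?R\<^esub> h \<in> ?K"
        using poly_ring_a_inv[of h V] h(1) K c
        by (auto simp: constants_def simp flip: single_uminus)
      show "h \<otimes>\<^bsub>?R\<^esub> h' \<in> ?K" "h \<oplus>\<^bsub>?R\<^esub> h' \<in> ?K"
        unfolding c by (auto simp: constants_def mult_single simp flip: single_add)
    qed
    show "Units (?R\<lparr>carrier := ?K\<rparr>) = ?K - {\<zero>\<^bsub>?R\<^esub>}"
    proof (intro equalityI subsetI)
      fix x assume "x \<in> Units (?R\<lparr>carrier := ?K\<rparr>)"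
      then show "x \<in> ?K - {\<zero>\<^bsub>?R\<^esub>}"
        by (auto simp: Units_def)
    next
      fix x assume "x \<in> ?K - {\<zero>\<^bsub>?R\<^esub>}"
      then obtain c where "x = single 0 c" "x \<noteq> 0"
        by (auto simp: constants_def)
      then have c: "x = single 0 c" "c \<noteq> 0"
        by auto
      have "single 0 (1 / c) \<in> ?K" "single 0 (1 / c) * x = 1" "x * single 0 (1 / c) = 1"
        using c by (auto simp: constants_def mult_single)
      then show "x \<in> Units (?R\<lparr>carrier := ?K\<rparr>)"
        using \<open>x \<in> ?K - _\<close> by (auto simp: Units_def)
    qed
  qed
qed

lemma Span_monomials:
  fixes ms :: "('v \<Rightarrow>\<^sub>0 nat) list"
  shows "ring.Span (poly_ring V) constants (map (\<lambda>m. single m 1) ms) =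
    {p :: ('v \<Rightarrow>\<^sub>0 nat) \<Rightarrow>\<^sub>0 'k::field. keys p \<subseteq> set ms}"
proof -
  let ?R = "poly_ring V :: (('v \<Rightarrow>\<^sub>0 nat) \<Rightarrow>\<^sub>0 'k) ring"
  interpret R: cring ?R by (rule cring_poly_ring)
  show ?thesis
  proof (induction ms)
    case (Cons m ms)
    have "p \<in> R.line_extension constants (single m 1) {p. keys p \<subseteq> set ms} \<longleftrightarrow>
        keys p \<subseteq> set (m # ms)" for p
    proof
      assume "p \<in> R.line_extension constants (single m 1) {p. keys p \<subseteq> set ms}"
      then obtain c q where "keys q \<subseteq> set ms" "p = single m c + q"
        by (auto simp: R.line_extension_mem_iff constants_def mult_single)
      then show "keys p \<subseteq> set (m # ms)"
        using Poly_Mapping.keys_add[of "single m c" q] by (auto split: if_splits)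
    next
      assume p: "keys p \<subseteq> set (m # ms)"
      define q where "q = p - single m (lookup p m)"
      have "keys q \<subseteq> set ms"
      proof
        fix x assume "x \<in> keys q"
        then have "x \<noteq> m" "x \<in> keys p"
          by (auto simp: q_def in_keys_iff lookup_minus lookup_single when_def split: if_splits)
        then show "x \<in> set ms" using p by auto
      qed
      moreover have "p = single 0 (lookup p m) * single m 1 + q"
        by (simp add: q_def mult_single)
      ultimately show "p \<in> R.line_extension constants (single m 1) {p. keys p \<subseteq> set ms}"
        unfolding R.line_extension_mem_iff constants_def poly_ring_simps by blast
    qed
    then show ?case
      using Cons.IH by auto
  qed simp
qed

text \<open>
  Monomials outside a monomial ideal are a basis of the quotient: a combination of them that
  lies in the ideal has all its terms in the ideal, and every homogeneous polynomial is congruent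
  to the part consisting of its terms outside the ideal.
\<close>

lemma dim_graded_quotient_mono_ideal:
  fixes J :: "(('v \<Rightarrow>\<^sub>0 nat) \<Rightarrow>\<^sub>0 'k::field) set"
  assumes "finite V" and U: "up_closed V U" "\<not> U {}" and J: "J = mono_ideal V U"
  shows "ring.dim (poly_ring V Quot J)
           ((\<lambda>p. J +>\<^bsub>poly_ring V\<^esub> p) ` constants) ((\<lambda>p. J +>\<^bsub>poly_ring V\<^esub> p) ` homogeneous V i) =
         card {m. keys m \<subseteq> V \<and> total_degree m = i \<and> \<not> U (keys m)}"
    (is "_ = card ?M")
proof -
  let ?R = "poly_ring V :: (('v \<Rightarrow>\<^sub>0 nat) \<Rightarrow>\<^sub>0 'k) ring"
  let ?A = "?R Quot J"
  have J_iff: "p \<in> J \<longleftrightarrow> p \<in> carrier ?R \<and> (\<forall>m\<in>keys p. U (keys m))" for p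
    by (simp add: J mono_ideal_def)
  have one_notin: "1 \<notin> J"
    using U(2) by (simp add: J_iff)
  define \<pi> where "\<pi> p = J +>\<^bsub>?R\<^esub> p" for p
  interpret R: cring ?R by (rule cring_poly_ring)
  interpret J: ideal J ?R unfolding J by (rule ideal_mono_ideal[OF U(1)])
  interpret A: cring ?A by (rule J.quotient_is_cring[OF cring_poly_ring])
  interpret hom: ring_hom_ring ?R ?A \<pi>
    using J.rcos_ring_hom_ring unfolding \<pi>_def .
  have \<pi>_eq: "\<pi> p = \<pi> q \<longleftrightarrow> p - q \<in> J" if "p \<in> carrier ?R" "q \<in> carrier ?R" for p q
    using R.quotient_eq_iff_same_a_r_cos[OF J.is_ideal that] poly_ring_a_minus[OF that(2)]
    by (simp add: \<pi>_def)
  have "\<pi> 1 \<noteq> \<pi> 0"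
    using \<pi>_eq[OF poly_ring_zero_one(2) poly_ring_zero_one(1)] one_notin
    unfolding diff_zero by blast
  then have "\<one>\<^bsub>?A\<^esub> \<noteq> \<zero>\<^bsub>?A\<^esub>"
    using hom.hom_one hom.hom_zero unfolding poly_ring_simps by metis
  then have K: "subfield (\<pi> ` constants) ?A"
    using hom.img_is_subfield(2)[OF subfield_constants] by blast
  have K_carrier: "constants \<subseteq> carrier ?R"
    by (rule subfieldE(3)[OF subfield_constants])
  have Span: "A.Span (\<pi> ` constants) (map (\<lambda>m. \<pi> (single m 1)) ms) = \<pi> ` {p. keys p \<subseteq> set ms}"
    if "\<And>m. m \<in> set ms \<Longrightarrow> keys m \<subseteq> V" for ms
  proof -
    have "set (map (\<lambda>m. single m 1) ms) \<subseteq> carrier ?R"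
      using that by (auto intro: poly_ring_single)
    from hom.Span_hom[OF K_carrier this] show ?thesis
      unfolding Span_monomials by (simp add: comp_def)
  qed
  have indep: "A.independent (\<pi> ` constants) (map (\<lambda>m. \<pi> (single m 1)) ms)"
    if "distinct ms" "\<And>m. m \<in> set ms \<Longrightarrow> keys m \<subseteq> V \<and> \<not> U (keys m)" for ms
    using that
  proof (induction ms)
    case (Cons m ms)
    have m: "single m 1 \<in> carrier ?R"
      using Cons.prems(2)[of m] by (simp add: poly_ring_single)
    have "\<pi> (single m 1) \<notin> \<pi> ` {p. keys p \<subseteq> set ms}"
    proof
      assume "\<pi> (single m 1) \<in> \<pi> ` {p. keys p \<subseteq> set ms}"
      then obtain p where p: "keys p \<subseteq> set ms" "\<pi> (single m 1) = \<pi> p" by blast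
      have pc: "p \<in> carrier ?R"
        using p(1) Cons.prems(2) by (auto simp: carrier_poly_ring_iff)
      have "single m 1 - p \<in> J"
        using \<pi>_eq[OF m pc] p(2) by simp
      moreover have "m \<notin> keys p"
        using Cons.prems(1) p(1) by auto
      then have "m \<in> keys (single m 1 - p)"
        by (simp add: in_keys_iff lookup_minus)
      ultimately show False
        using Cons.prems(2)[of m] unfolding J_iff by auto
    qed
    then have "\<pi> (single m 1) \<notin> A.Span (\<pi> ` constants) (map (\<lambda>m. \<pi> (single m 1)) ms)"
      using Span[of ms] Cons.prems(2) by simp
    moreover have "A.independent (\<pi> ` constants) (map (\<lambda>m. \<pi> (single m 1)) ms)"
      using Cons by simp
    ultimately show ?case
      unfolding list.map by (intro A.li_Cons hom.hom_closed m)
  qed simp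
  have "finite ?M"
    by (rule finite_subset[OF _ finite_monomials_of_degree[OF assms(1), of i]]) auto
  then obtain ms where ms: "set ms = ?M" "distinct ms"
    using finite_distinct_list[OF \<open>finite ?M\<close>] by metis
  have "A.Span (\<pi> ` constants) (map (\<lambda>m. \<pi> (single m 1)) ms) = \<pi> ` {p. keys p \<subseteq> ?M}"
    by (rule Span[of ms, unfolded ms(1)]) blast
  also have "\<dots> = \<pi> ` homogeneous V i"
  proof (intro equalityI subsetI)
    fix x assume "x \<in> \<pi> ` {p. keys p \<subseteq> ?M}"
    moreover have "{p. keys p \<subseteq> ?M} \<subseteq> homogeneous V i"
      unfolding homogeneous_iff subset_iff by blast
    ultimately show "x \<in> \<pi> ` homogeneous V i" by blast
  next
    fix x assume "x \<in> \<pi> ` homogeneous V i"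
    then obtain p where p: "p \<in> homogeneous V i" "x = \<pi> p" by blast
    obtain q where q: "keys q \<subseteq> {m \<in> keys p. \<not> U (keys m)}" "keys (p - q) \<subseteq> {m \<in> keys p. \<not> \<not> U (keys m)}"
      by (rule split_polynomial)
    have "p - q \<in> J" "p \<in> carrier ?R" "q \<in> carrier ?R"
      using p(1) q unfolding J_iff carrier_poly_ring_iff homogeneous_iff by blast+
    then have "x = \<pi> q"
      using p(2) \<pi>_eq by simp
    moreover have "keys q \<subseteq> ?M"
      using q(1) p(1) by (auto simp: homogeneous_iff)
    ultimately show "x \<in> \<pi> ` {p. keys p \<subseteq> ?M}" by blast
  qed
  finally have "A.dimension (length (map (\<lambda>m. \<pi> (single m 1)) ms)) (\<pi> ` constants) (\<pi> ` homogeneous V i)"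
    using A.dimensionI[OF K indep[OF ms(2)]] ms(1) by blast
  then have "A.dim (\<pi> ` constants) (\<pi> ` homogeneous V i) = length ms"
    using A.dimI[OF K] by (simp add: over_def)
  then show ?thesis
    using distinct_card[OF ms(2)] ms(1) by (simp add: \<pi>_def)
qed

definition exact_support_series :: "'v set \<Rightarrow> int fps" where
  "exact_support_series F =
     Abs_fps (\<lambda>i. int (card {m :: 'v \<Rightarrow>\<^sub>0 nat. keys m = F \<and> total_degree m = i}))"

text \<open>
  A monomial with support \<open>insert v F\<close> is \<open>x\<^sub>v\<close> times a monomial of support
  \<open>insert v F\<close> or \<open>F\<close>, so the series \<open>N'\<close> of \<open>insert v F\<close> and \<open>N\<close> of \<open>F\<close>
  satisfy \<open>N' = t (N' + N)\<close>.
\<close>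

lemma exact_support_series_insert:
  fixes F :: "'v set"
  assumes "finite F" "v \<notin> F"
  shows "exact_support_series (insert v F) * (1 - fps_X) = fps_X * exact_support_series F"
proof -
  define deg :: "('v \<Rightarrow>\<^sub>0 nat) \<Rightarrow> nat" where "deg m = total_degree m" for m
  define M where "M F i = {m. keys m = F \<and> deg m = i}" for F i
  have nth: "fps_nth (exact_support_series F) i = int (card (M F i))" for F i
    by (simp add: exact_support_series_def M_def deg_def)
  have deg_add: "deg (m + single v 1) = Suc (deg m)" for m
    unfolding deg_def total_degree_add by simp
  have finM: "finite (M F i)" if "finite F" for F i
    by (rule finite_subset[OF _ finite_monomials_of_degree[OF that, of i]])
      (auto simp: M_def deg_def)
  have "m \<notin> M (insert v F) 0" for m
  proof
    assume "m \<in> M (insert v F) 0"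
    then have "v \<in> keys m" "lookup m v = 0"
      by (auto simp: M_def deg_def)
    then show False by (simp add: in_keys_iff)
  qed
  then have "M (insert v F) 0 = {}" by blast
  moreover have "card (M (insert v F) (Suc i)) = card (M (insert v F) i) + card (M F i)" for i
  proof -
    have "bij_betw (\<lambda>m. m + single v 1) (M (insert v F) i \<union> M F i) (M (insert v F) (Suc i))"
    proof (rule bij_betw_byWitness[where f' = "\<lambda>m. m - single v 1"])
      have cancel: "m - single v 1 + single v 1 = m" if "v \<in> keys m" for m :: "'v \<Rightarrow>\<^sub>0 nat"
      proof (rule poly_mapping_eqI)
        fix x
        show "lookup (m - single v 1 + single v 1) x = lookup m x"
          using that by (auto simp: lookup_add lookup_minus lookup_single when_def in_keys_iff)
      qed
      show "\<forall>m\<in>M (insert v F) i \<union> M F i. m + single v 1 - single v 1 = m"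
        by simp
      show "\<forall>m\<in>M (insert v F) (Suc i). m - single v 1 + single v 1 = m"
        using cancel by (simp add: M_def)
      show "(\<lambda>m. m + single v 1) ` (M (insert v F) i \<union> M F i) \<subseteq> M (insert v F) (Suc i)"
      proof (rule image_subsetI)
        fix m assume "m \<in> M (insert v F) i \<union> M F i"
        then have "deg m = i" "insert v (keys m) = insert v F"
          by (auto simp: M_def)
        then show "m + single v 1 \<in> M (insert v F) (Suc i)"
          using deg_add[of m] by (simp add: M_def keys_add_nat)
      qed
      show "(\<lambda>m. m - single v 1) ` M (insert v F) (Suc i) \<subseteq> M (insert v F) i \<union> M F i"
      proof (rule image_subsetI)
        fix m assume m: "m \<in> M (insert v F) (Suc i)"
        define m' where "m' = m - single v 1"
        have eq: "m' + single v 1 = m"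
          unfolding m'_def using m by (intro cancel) (simp add: M_def)
        have "deg m = Suc (deg m')"
          unfolding eq[symmetric] deg_add ..
        moreover have "keys m = insert v (keys m')"
          unfolding eq[symmetric] keys_add_nat by simp
        ultimately have "deg m' = i" "insert v (keys m') = insert v F"
          using m by (auto simp: M_def)
        then have "keys m' = insert v F \<or> keys m' = F"
          using assms(2) by (cases "v \<in> keys m'") auto
        then show "m - single v 1 \<in> M (insert v F) i \<union> M F i"
          using \<open>deg m' = i\<close> by (auto simp: M_def m'_def)
      qed
    qed
    from bij_betw_same_card[OF this] have "card (M (insert v F) (Suc i)) = card (M (insert v F) i \<union> M F i)"
      by simp
    also have "\<dots> = card (M (insert v F) i) + card (M F i)"
      using assms by (intro card_Un_disjoint finM) (auto simp: M_def)
    finally show ?thesis .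
  qed
  ultimately have "fps_nth (exact_support_series (insert v F) * (1 - fps_X)) n =
      fps_nth (fps_X * exact_support_series F) n" for n
    by (cases n) (simp_all add: nth right_diff_distrib mult.commute[of _ fps_X])
  then show ?thesis
    by (rule fps_ext)
qed

lemma exact_support_series_eq:
  fixes F :: "'v set"
  assumes "finite F"
  shows "exact_support_series F * (1 - fps_X) ^ card F = fps_X ^ card F"
  using assms
proof (induction F rule: finite_induct)
  case empty
  have "{m :: 'v \<Rightarrow>\<^sub>0 nat. keys m = {} \<and> total_degree m = i} = (if i = 0 then {0} else {})" for i
    by auto
  then have "fps_nth (exact_support_series ({} :: 'v set)) i = fps_nth 1 i" for i
    unfolding exact_support_series_def fps_nth_Abs_fps by simp
  then have "exact_support_series ({} :: 'v set) = 1"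
    by (rule fps_ext)
  then show ?case by simp
next
  case (insert v F)
  have "exact_support_series (insert v F) * (1 - fps_X) ^ card (insert v F) =
      (exact_support_series (insert v F) * (1 - fps_X)) * (1 - fps_X) ^ card F"
    using insert.hyps by (simp add: mult.assoc)
  also have "\<dots> = fps_X * (exact_support_series F * (1 - fps_X) ^ card F)"
    by (simp only: exact_support_series_insert[OF insert.hyps] mult.assoc)
  finally show ?case
    using insert by simp
qed

text \<open>
  Sorting the monomial basis by supports \<open>F\<close>, each of which contributes \<open>t\<^bsup>|F|\<^esup> / (1 - t)\<^bsup>|F|\<^esup>\<close>.
  Multiplication by \<open>(1 - t)\<^bsup>|V|\<^esup>\<close> avoids division.
\<close>

lemma hilbert_series_quotient_mono_ideal:
  fixes J :: "(('v \<Rightarrow>\<^sub>0 nat) \<Rightarrow>\<^sub>0 'k::field) set"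
  assumes fin: "finite V" and U: "up_closed V U" "\<not> U {}" and J: "J = mono_ideal V U"
  shows "hilbert_series (poly_ring V Quot J) ((\<lambda>p. J +>\<^bsub>poly_ring V\<^esub> p) ` constants)
      (\<lambda>i. (\<lambda>p. J +>\<^bsub>poly_ring V\<^esub> p) ` homogeneous V i) * (1 - fps_X) ^ card V =
    (\<Sum>F | F \<subseteq> V \<and> \<not> U F. fps_X ^ card F * (1 - fps_X) ^ (card V - card F))" (is "?H * _ = _")
proof -
  have finF: "finite {F. F \<subseteq> V \<and> \<not> U F}"
    using fin by simp
  have "?H = (\<Sum>F | F \<subseteq> V \<and> \<not> U F. exact_support_series F)"
  proof (rule fps_ext)
    fix i
    have "{m :: 'v \<Rightarrow>\<^sub>0 nat. keys m \<subseteq> V \<and> total_degree m = i \<and> \<not> U (keys m)} =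
        (\<Union>F\<in>{F. F \<subseteq> V \<and> \<not> U F}. {m. keys m = F \<and> total_degree m = i})"
      by auto
    moreover have "card \<dots> = (\<Sum>F | F \<subseteq> V \<and> \<not> U F. card {m :: 'v \<Rightarrow>\<^sub>0 nat. keys m = F \<and> total_degree m = i})"
    proof (rule card_UN_disjoint[OF finF])
      show "\<forall>F\<in>{F. F \<subseteq> V \<and> \<not> U F}. finite {m :: 'v \<Rightarrow>\<^sub>0 nat. keys m = F \<and> total_degree m = i}"
        by (auto intro!: finite_subset[OF _ finite_monomials_of_degree[OF fin, of i]])
    qed auto
    ultimately show "fps_nth ?H i = fps_nth (\<Sum>F | F \<subseteq> V \<and> \<not> U F. exact_support_series F) i"
      unfolding hilbert_series_def fps_nth_Abs_fps dim_graded_quotient_mono_ideal[OF assms]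
      by (simp add: fps_sum_nth exact_support_series_def)
  qed
  then have "?H * (1 - fps_X) ^ card V =
      (\<Sum>F | F \<subseteq> V \<and> \<not> U F. exact_support_series F * (1 - fps_X) ^ card V)"
    by (simp add: sum_distrib_right)
  also have "\<dots> = (\<Sum>F | F \<subseteq> V \<and> \<not> U F. fps_X ^ card F * (1 - fps_X) ^ (card V - card F))"
  proof (rule sum.cong[OF refl])
    fix F assume "F \<in> {F. F \<subseteq> V \<and> \<not> U F}"
    then have "finite F" "card F \<le> card V"
      using fin by (auto intro: finite_subset card_mono)
    then have "card V = card F + (card V - card F)"
      by simp
    then have "exact_support_series F * (1 - fps_X) ^ card V =
        (exact_support_series F * (1 - fps_X) ^ card F) * (1 - fps_X) ^ (card V - card F)"
      by (metis mult.assoc power_add)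
    then show "exact_support_series F * (1 - fps_X) ^ card V = fps_X ^ card F * (1 - fps_X) ^ (card V - card F)"
      by (simp add: exact_support_series_eq[OF \<open>finite F\<close>])
  qed
  finally show ?thesis .
qed

section \<open>The homogeneous independence polynomial of a graph\<close>

definition independent_sets :: "'v sgraph \<Rightarrow> 'v set set" where
  "independent_sets G = {I. I \<subseteq> verts G \<and> (\<forall>e\<in>edges G. \<not> e \<subseteq> I)}"

text \<open>
  The independence polynomial of \<open>G\<close>, homogenized to degree \<open>|V(G)|\<close>. Vertices outside an
  independent set have weight \<open>a\<close> and those inside have weight \<open>b\<close>, so that edgeless parts
  contribute powers of \<open>a + b\<close>.
\<close>

definition independence_form :: "'v sgraph \<Rightarrow> 'a \<Rightarrow> 'a \<Rightarrow> 'a::comm_ring_1" where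
  "independence_form G a b =
     (\<Sum>I\<in>independent_sets G. a ^ (card (verts G) - card I) * b ^ card I)"

lemma sum_Pow_binomial:
  fixes a b :: "'a::comm_ring_1"
  assumes fin: "finite V" and N: "N = c + card V"
  shows "(\<Sum>S\<in>Pow V. a ^ (N - card S) * b ^ card S) = a ^ c * (a + b) ^ card V"
proof -
  have "(\<Sum>S\<in>Pow V. a ^ (N - card S) * b ^ card S) =
      (\<Sum>S\<in>Pow V. a ^ c * ((\<Prod>v\<in>S. b) * (\<Prod>v\<in>V - S. a)))"
  proof (rule sum.cong[OF refl])
    fix S assume "S \<in> Pow V"
    then have "card S \<le> card V" "card (V - S) = card V - card S"
      using fin by (auto simp: card_mono intro!: card_Diff_subset finite_subset[of S V])
    then have "N - card S = c + card (V - S)"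
      using N by simp
    then show "a ^ (N - card S) * b ^ card S = a ^ c * ((\<Prod>v\<in>S. b) * (\<Prod>v\<in>V - S. a))"
      by (simp add: power_add mult_ac)
  qed
  also have "\<dots> = a ^ c * (\<Prod>v\<in>V. b + a)"
    unfolding sum_distrib_left[symmetric] prod_add[OF fin] ..
  finally show ?thesis by (simp add: add.commute)
qed

lemma finite_independent_sets: "finite (verts G) \<Longrightarrow> finite (independent_sets G)"
  by (rule finite_subset[of _ "Pow (verts G)"]) (auto simp: independent_sets_def)

lemma card_independent_set_le:
  "finite (verts G) \<Longrightarrow> I \<in> independent_sets G \<Longrightarrow> card I \<le> card (verts G)"
  by (auto simp: independent_sets_def intro: card_mono)

lemma sum_vertex_covers:
  fixes a b :: "'a::comm_ring_1"
  assumes "finite (verts G)" "\<And>e. e \<in> edges G \<Longrightarrow> e \<subseteq> verts G"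
  shows "(\<Sum>F | vertex_cover G F. a ^ card F * b ^ (card (verts G) - card F)) = independence_form G a b"
  unfolding independence_form_def
proof (rule sum.reindex_bij_witness[where i = "\<lambda>I. verts G - I" and j = "\<lambda>F. verts G - F"])
  fix F assume F: "F \<in> {F. vertex_cover G F}"
  then have sub: "F \<subseteq> verts G" by (simp add: vertex_cover_def)
  show "verts G - (verts G - F) = F" using sub by blast
  show "verts G - F \<in> independent_sets G"
    using F by (fastforce simp: vertex_cover_def independent_sets_def)
  have "card F \<le> card (verts G)" "card (verts G - F) = card (verts G) - card F"
    using sub assms(1) by (auto simp: card_mono card_Diff_subset finite_subset)
  then show "a ^ (card (verts G) - card (verts G - F)) * b ^ card (verts G - F) =
      a ^ card F * b ^ (card (verts G) - card F)"
    by simp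
next
  fix I assume I: "I \<in> independent_sets G"
  then show "verts G - (verts G - I) = I"
    by (auto simp: independent_sets_def)
  have "e \<inter> (verts G - I) \<noteq> {}" if "e \<in> edges G" for e
    using I assms(2)[OF that] that unfolding independent_sets_def by blast
  then show "verts G - I \<in> {F. vertex_cover G F}"
    by (simp add: vertex_cover_def)
qed

lemma independence_form_disjoint_union:
  fixes a b :: "'a::comm_ring_1"
  assumes G: "finite (verts G)" and H: "finite (verts H)"
  shows "independence_form (disjoint_union G H) a b = independence_form G a b * independence_form H a b"
proof -
  let ?term = "\<lambda>G I. a ^ (card (verts G) - card I) * b ^ card I"
  have "independence_form (disjoint_union G H) a b =
      (\<Sum>(I, I')\<in>independent_sets G \<times> independent_sets H. ?term G I * ?term H I')"
    unfolding independence_form_def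
  proof (rule sum.reindex_bij_witness[where i = "\<lambda>(I, I'). I <+> I'" and j = "\<lambda>I. (Inl -` I, Inr -` I)"])
    fix K assume K: "K \<in> independent_sets (disjoint_union G H)"
    show K_eq: "(case (Inl -` K, Inr -` K) of (I, I') \<Rightarrow> I <+> I') = K"
      by (auto simp: Plus_def vimage_def image_iff) (metis obj_sumE)+
    have "K \<subseteq> verts G <+> verts H" "\<And>e. e \<in> edges G \<Longrightarrow> \<not> Inl ` e \<subseteq> K" "\<And>e. e \<in> edges H \<Longrightarrow> \<not> Inr ` e \<subseteq> K"
      using K by (auto simp: independent_sets_def disjoint_union_def)
    then show mem: "(Inl -` K, Inr -` K) \<in> independent_sets G \<times> independent_sets H"
      by (fastforce simp: independent_sets_def)
    have "finite (Inl -` K)" "finite (Inr -` K)"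
      using mem G H finite_subset unfolding independent_sets_def by blast+
    then have "card K = card (Inl -` K) + card (Inr -` K)"
      using card_Plus[of "Inl -` K" "Inr -` K"] K_eq by simp
    moreover have "card (Inl -` K) \<le> card (verts G)" "card (Inr -` K) \<le> card (verts H)"
      using mem card_independent_set_le G H by auto
    moreover have "card (verts (disjoint_union G H)) = card (verts G) + card (verts H)"
      using G H by (simp add: disjoint_union_def card_Plus)
    ultimately have "card (verts (disjoint_union G H)) - card K =
        (card (verts G) - card (Inl -` K)) + (card (verts H) - card (Inr -` K))"
      "card K = card (Inl -` K) + card (Inr -` K)"
      by simp_all
    then show "(case (Inl -` K, Inr -` K) of (I, I') \<Rightarrow> ?term G I * ?term H I') = ?term (disjoint_union G H) K"
      by (simp add: power_add mult_ac)
  next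
    fix p assume "p \<in> independent_sets G \<times> independent_sets H"
    then obtain I I' where p: "p = (I, I')" "I \<in> independent_sets G" "I' \<in> independent_sets H"
      by blast
    show "(Inl -` (case p of (I, I') \<Rightarrow> I <+> I'), Inr -` (case p of (I, I') \<Rightarrow> I <+> I')) = p"
      by (auto simp: p(1))
    have "I <+> I' \<subseteq> verts G <+> verts H" 
      using p(2,3) by (auto simp: independent_sets_def)
    moreover have "\<not> Inl ` e \<subseteq> I <+> I'" if "e \<in> edges G" for e
      using p(2) that by (auto simp: independent_sets_def)
    moreover have "\<not> Inr ` e \<subseteq> I <+> I'" if "e \<in> edges H" for e
      using p(3) that by (auto simp: independent_sets_def)
    ultimately show "(case p of (I, I') \<Rightarrow> I <+> I') \<in> independent_sets (disjoint_union G H)"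
      by (auto simp: p(1) independent_sets_def disjoint_union_def)
  qed
  also have "\<dots> = independence_form G a b * independence_form H a b"
    unfolding independence_form_def sum_product sum.cartesian_product ..
  finally show ?thesis .
qed

lemma independent_sets_cone:
  assumes "{} \<notin> edges G"
  shows "independent_sets (cone G) = insert {None} ((`) Some ` independent_sets G)"
proof (intro equalityI subsetI)
  fix K assume K: "K \<in> independent_sets (cone G)"
  have K1: "K \<subseteq> insert None (Some ` verts G)" "\<And>e. e \<in> edges G \<Longrightarrow> \<not> Some ` e \<subseteq> K"
    "\<And>v. v \<in> verts G \<Longrightarrow> \<not> {None, Some v} \<subseteq> K"
    using K unfolding independent_sets_def cone_def sgraph.simps by blast+
  show "K \<in> insert {None} ((`) Some ` independent_sets G)"
  proof (cases "None \<in> K")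
    case True
    then have "K = {None}" using K1(1,3) by blast
    then show ?thesis by simp
  next
    case False
    then have "K = Some ` (Some -` K)"
      using K1(1) by blast
    moreover have "Some -` K \<in> independent_sets G"
      using K1(1,2) by (fastforce simp: independent_sets_def)
    ultimately show ?thesis by blast
  qed
next
  fix K assume K: "K \<in> insert {None} ((`) Some ` independent_sets G)"
  show "K \<in> independent_sets (cone G)"
  proof (cases "K = {None}")
    case True
    have "\<not> Some ` e \<subseteq> {None}" if "e \<in> edges G" for e
      using assms that by (cases "e = {}") auto
    then show ?thesis
      unfolding True by (auto simp: independent_sets_def cone_def)
  next
    case False
    then obtain I where I: "K = Some ` I" "I \<in> independent_sets G"
      using K by blast
    have "\<not> Some ` e \<subseteq> Some ` I" if "e \<in> edges G" for e
      using I(2) that by (simp add: independent_sets_def inj_image_subset_iff)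
    then show ?thesis
      using I(2) unfolding I(1) by (auto simp: independent_sets_def cone_def)
  qed
qed

lemma independence_form_cone:
  fixes a b :: "'a::comm_ring_1"
  assumes fin: "finite (verts G)" and "{} \<notin> edges G"
  shows "independence_form (cone G) a b = a * independence_form G a b + b * a ^ card (verts G)"
proof -
  have cardV: "card (verts (cone G)) = Suc (card (verts G))"
    using fin by (simp add: cone_def card_image)
  have "independence_form (cone G) a b =
     a ^ card (verts G) * b + (\<Sum>K\<in>(`) Some ` independent_sets G. a ^ (Suc (card (verts G)) - card K) * b ^ card K)"
    unfolding independence_form_def independent_sets_cone[OF assms(2)] cardV
    using fin by (subst sum.insert) (auto simp: finite_independent_sets)
  also have "(\<Sum>K\<in>(`) Some ` independent_sets G. a ^ (Suc (card (verts G)) - card K) * b ^ card K) =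
      (\<Sum>I\<in>independent_sets G. a ^ (Suc (card (verts G)) - card I) * b ^ card I)"
    by (subst sum.reindex) (auto simp: inj_on_def inj_image_eq_iff card_image)
  also have "\<dots> = a * independence_form G a b"
    unfolding independence_form_def sum_distrib_left
    by (rule sum.cong) (simp_all add: Suc_diff_le card_independent_set_le[OF fin] mult.assoc)
  finally show ?thesis by (simp add: mult.commute add.commute)
qed

lemma independence_form_star:
  fixes a b :: "'a::comm_ring_1"
  shows "independence_form (star r) a b = a * (a + b) ^ r + b * a ^ r"
proof -
  let ?L = "Leaf ` {1..r}"
  have cardL: "card ?L = r" by (simp add: card_image inj_on_def)
  have cardV: "card (verts (star r)) = Suc r"
    by (simp add: star_def card_image inj_on_def image_iff)
  have "independent_sets (star r) = insert {Centre} (Pow ?L)"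
  proof (intro equalityI subsetI)
    fix K assume "K \<in> independent_sets (star r)"
    then have K: "K \<subseteq> insert Centre ?L" "\<And>i. i \<in> {1..r} \<Longrightarrow> \<not> {Centre, Leaf i} \<subseteq> K"
      unfolding independent_sets_def star_def sgraph.simps by blast+
    show "K \<in> insert {Centre} (Pow ?L)"
      using K by (cases "Centre \<in> K") blast+
  next
    fix K assume "K \<in> insert {Centre} (Pow ?L)"
    then have "K \<subseteq> insert Centre ?L" "\<And>i. \<not> {Centre, Leaf i} \<subseteq> K"
      by auto
    then show "K \<in> independent_sets (star r)"
      unfolding independent_sets_def star_def sgraph.simps by blast
  qed
  then have "independence_form (star r) a b =
      a ^ r * b + (\<Sum>S\<in>Pow ?L. a ^ (Suc r - card S) * b ^ card S)"
    unfolding independence_form_def cardV by (simp add: image_iff)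
  also have "(\<Sum>S\<in>Pow ?L. a ^ (Suc r - card S) * b ^ card S) = a * (a + b) ^ r"
    using sum_Pow_binomial[of ?L "Suc r" 1 a b] unfolding cardL by simp
  finally show ?thesis by (simp add: mult.commute add.commute)
qed

text \<open>
  The clique admits at most one \<open>c\<^sub>i\<close>, and \<open>c\<^sub>i\<close> is compatible exactly with the \<open>z\<^sub>j\<close> with \<open>j < i\<close>.
\<close>

lemma independent_sets_B_graph:
  "independent_sets (B_graph k) =
    Pow (ZV ` {1..k - 1}) \<union> (\<Union>i\<in>{1..k + 1}. insert (CV i) ` Pow (ZV ` {j \<in> {1..k - 1}. j < i}))"
    (is "_ = ?Z \<union> ?C")
proof (intro equalityI subsetI)
  fix K assume K: "K \<in> independent_sets (B_graph k)"
  have K1: "K \<subseteq> CV ` {1..k + 1} \<union> ZV ` {1..k - 1}"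
    and K2: "\<And>i j. CV i \<in> K \<Longrightarrow> CV j \<in> K \<Longrightarrow> i \<in> {1..k + 1} \<Longrightarrow> j \<in> {1..k + 1} \<Longrightarrow> i = j"
    and K3: "\<And>i j. ZV j \<in> K \<Longrightarrow> CV i \<in> K \<Longrightarrow> j \<in> {1..k - 1} \<Longrightarrow> 1 \<le> i \<Longrightarrow> j < i"
  proof -
    have *: "K \<subseteq> verts (B_graph k)" "\<And>e. e \<in> edges (B_graph k) \<Longrightarrow> \<not> e \<subseteq> K"
      using K by (auto simp: independent_sets_def)
    show "K \<subseteq> CV ` {1..k + 1} \<union> ZV ` {1..k - 1}"
      using *(1) by (simp add: B_graph_def)
    show "i = j" if "CV i \<in> K" "CV j \<in> K" "i \<in> {1..k + 1}" "j \<in> {1..k + 1}" for i j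
    proof (rule ccontr)
      assume "i \<noteq> j"
      then have "{CV i, CV j} \<in> edges (B_graph k)"
        using that unfolding B_graph_def sgraph.simps by blast
      then show False using *(2) that by blast
    qed
    show "j < i" if "ZV j \<in> K" "CV i \<in> K" "j \<in> {1..k - 1}" "1 \<le> i" for i j
    proof (rule ccontr)
      assume "\<not> j < i"
      then have "i \<in> {1..j}" using that by simp
      then have "{ZV j, CV i} \<in> edges (B_graph k)"
        using that unfolding B_graph_def sgraph.simps by blast
      then show False using *(2) that by blast
    qed
  qed
  show "K \<in> ?Z \<union> ?C"
  proof (cases "\<exists>i. CV i \<in> K")
    case False
    then have "K \<subseteq> ZV ` {1..k - 1}" using K1 by blast
    then show ?thesis by blast
  next
    case True
    then obtain i where i: "CV i \<in> K" by blast
    then have ik: "i \<in> {1..k + 1}" using K1 by blast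
    have "K - {CV i} \<subseteq> ZV ` {j \<in> {1..k - 1}. j < i}"
    proof
      fix x assume x: "x \<in> K - {CV i}"
      then consider j where "x = CV j" "j \<in> {1..k + 1}" | j where "x = ZV j" "j \<in> {1..k - 1}"
        using K1 by blast
      then show "x \<in> ZV ` {j \<in> {1..k - 1}. j < i}"
      proof cases
        case 1
        then show ?thesis using K2[of i j] x i ik by simp
      next
        case 2
        then show ?thesis using K3[of j i] x i ik by simp
      qed
    qed
    then have "K \<in> insert (CV i) ` Pow (ZV ` {j \<in> {1..k - 1}. j < i})"
      using i by (intro image_eqI[of _ _ "K - {CV i}"]) auto
    then show ?thesis using ik by blast
  qed
next
  fix K assume "K \<in> ?Z \<union> ?C"
  then consider "K \<subseteq> ZV ` {1..k - 1}"
    | i S where "i \<in> {1..k + 1}" "S \<subseteq> ZV ` {j \<in> {1..k - 1}. j < i}" "K = insert (CV i) S"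
    by blast
  then have K: "K \<subseteq> verts (B_graph k)" "\<And>i j. CV i \<in> K \<Longrightarrow> CV j \<in> K \<Longrightarrow> i = j"
    "\<And>i j. ZV j \<in> K \<Longrightarrow> CV i \<in> K \<Longrightarrow> j < i"
    by (cases; auto simp: B_graph_def)+
  have "\<not> e \<subseteq> K" if "e \<in> edges (B_graph k)" for e
  proof -
    from that consider i j where "e = {CV i, CV j}" "i \<noteq> j" | i j where "e = {ZV j, CV i}" "i \<le> j"
      unfolding B_graph_def sgraph.simps by force
    then show ?thesis
      using K(2,3) by cases (metis insert_subset not_less)+
  qed
  then show "K \<in> independent_sets (B_graph k)"
    using K(1) by (simp add: independent_sets_def)
qed

text \<open>
  With \<open>a + b = 1\<close> every free choice of a set of \<open>z\<^sub>j\<close> sums to 1. The independent sets without any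
  \<open>c\<^sub>i\<close> then give \<open>a\<^bsup>k+1\<^esup>\<close>, those with \<open>c\<^sub>i\<close>, \<open>i \<le> k\<close>, give \<open>(1 - a) a\<^bsup>2k-i\<^esup>\<close> and telescope to
  \<open>a\<^bsup>k\<^esup> - a\<^bsup>2k\<^esup>\<close>, and those with \<open>c\<^bsub>k+1\<^esub>\<close> give \<open>(1 - a) a\<^bsup>k\<^esup>\<close>.
\<close>

lemma independence_form_B_graph:
  fixes a :: "'a::comm_ring_1"
  assumes k: "k \<ge> 1"
  shows "independence_form (B_graph k) a (1 - a) = 2 * a ^ k - a ^ (2 * k)"
proof -
  define Z where "Z i = ZV ` {j \<in> {1..k - 1}. j < i}" for i
  let ?t = "\<lambda>K. a ^ (2 * k - card K) * (1 - a) ^ card K"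
  have cardV: "card (verts (B_graph k)) = 2 * k"
  proof -
    have "card (CV ` {1..k + 1} \<union> ZV ` {1..k - 1}) = (k + 1) + (k - 1)"
      by (subst card_Un_disjoint) (auto simp: card_image inj_on_def)
    then show ?thesis using k by (simp add: B_graph_def)
  qed
  have finZ: "finite (Z i)" for i by (simp add: Z_def)
  have cardZ: "card (Z i) = min (i - 1) (k - 1)" for i
  proof -
    have "{j \<in> {1..k - 1}. j < i} = {1..min (i - 1) (k - 1)}" by auto
    then show ?thesis unfolding Z_def by (simp add: card_image inj_on_def)
  qed
  have cardZ0: "card (ZV ` {1..k - 1}) = k - 1"
    by (simp add: card_image inj_on_def)
  have CZ: "CV i \<notin> S" if "S \<subseteq> Z l" for i l S
    using that by (auto simp: Z_def)
  have "independence_form (B_graph k) a (1 - a) =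
      sum ?t (Pow (ZV ` {1..k - 1})) + sum ?t (\<Union>i\<in>{1..k + 1}. insert (CV i) ` Pow (Z i))"
    unfolding independence_form_def independent_sets_B_graph cardV Z_def[symmetric]
    by (rule sum.union_disjoint) (auto simp: finZ)
  also have "sum ?t (Pow (ZV ` {1..k - 1})) = a ^ (k + 1)"
  proof -
    have "2 * k = (k + 1) + card (ZV ` {1..k - 1})"
      unfolding cardZ0 using k by simp
    from sum_Pow_binomial[OF _ this, of a "1 - a"] show ?thesis
      by simp
  qed
  also have "sum ?t (\<Union>i\<in>{1..k + 1}. insert (CV i) ` Pow (Z i)) =
      (\<Sum>i\<in>{1..k + 1}. sum ?t (insert (CV i) ` Pow (Z i)))"
  proof (rule sum.UNION_disjoint)
    show "\<forall>i\<in>{1..k + 1}. \<forall>j\<in>{1..k + 1}. i \<noteq> j \<longrightarrow>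
        insert (CV i) ` Pow (Z i) \<inter> insert (CV j) ` Pow (Z j) = {}"
      by (auto simp: Z_def)
  qed (auto simp: finZ)
  also have "\<dots> = (\<Sum>i\<in>{1..k + 1}. (1 - a) * a ^ (2 * k - 1 - min (i - 1) (k - 1)))"
  proof (rule sum.cong[OF refl])
    fix i
    have "sum ?t (insert (CV i) ` Pow (Z i)) = (\<Sum>S\<in>Pow (Z i). ?t (insert (CV i) S))"
    proof (rule sum.reindex[unfolded comp_def])
      show "inj_on (insert (CV i)) (Pow (Z i))"
        by (rule inj_onI) (metis CZ PowD insert_ident)
    qed
    also have "\<dots> = (\<Sum>S\<in>Pow (Z i). (1 - a) *
        (a ^ (2 * k - 1 - card S) * (1 - a) ^ card S))"
    proof (rule sum.cong[OF refl])
      fix S assume S: "S \<in> Pow (Z i)"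
      then have "card (insert (CV i) S) = Suc (card S)"
        using CZ[of S i i] finite_subset[of S "Z i"] finZ by simp
      then show "?t (insert (CV i) S) = (1 - a) * (a ^ (2 * k - 1 - card S) * (1 - a) ^ card S)"
        by (simp add: mult_ac)
    qed
    also have "\<dots> = (1 - a) * a ^ (2 * k - 1 - card (Z i))"
    proof -
      have "2 * k - 1 = (2 * k - 1 - card (Z i)) + card (Z i)"
        using k by (simp add: cardZ)
      from sum_Pow_binomial[OF finZ this, of a "1 - a"] show ?thesis
        unfolding sum_distrib_left[symmetric] by simp
    qed
    finally show "sum ?t (insert (CV i) ` Pow (Z i)) = (1 - a) * a ^ (2 * k - 1 - min (i - 1) (k - 1))"
      by (simp add: cardZ)
  qed
  also have "\<dots> = (\<Sum>i\<in>{1..k}. (1 - a) * a ^ (2 * k - i)) + (1 - a) * a ^ k"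
  proof -
    have "(\<Sum>i\<in>{1..k}. (1 - a) * a ^ (2 * k - 1 - min (i - 1) (k - 1))) = (\<Sum>i\<in>{1..k}. (1 - a) * a ^ (2 * k - i))"
      by (rule sum.cong) (auto simp: min_def)
    moreover have "2 * k - 1 - min (k + 1 - 1) (k - 1) = k"
      using k by (simp add: min_def)
    ultimately show ?thesis by simp
  qed
  also have "(\<Sum>i\<in>{1..k}. (1 - a) * a ^ (2 * k - i)) = a ^ k - a ^ (2 * k)"
  proof -
    have "l \<le> 2 * k \<Longrightarrow> (\<Sum>i\<in>{1..l}. (1 - a) * a ^ (2 * k - i)) = a ^ (2 * k - l) - a ^ (2 * k)" for l
    proof (induction l)
      case (Suc l)
      then have "2 * k - l = Suc (2 * k - Suc l)" by simp
      then show ?case using Suc by (simp add: algebra_simps)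
    qed simp
    from this[of k] show ?thesis by simp
  qed
  finally show ?thesis by (simp add: algebra_simps)
qed

section \<open>The h-polynomial of a cover ideal\<close>

text \<open>
  The factor \<open>(1 - t)\<^sup>2\<close> accounts for the difference between the number of variables and the Krull
  dimension.
\<close>

lemma quotient_h_polynomial_cover_ideal:
  fixes J :: "(('v \<Rightarrow>\<^sub>0 nat) \<Rightarrow>\<^sub>0 'k::field) set"
  assumes fin: "finite (verts G)" and edge: "\<And>e. e \<in> edges G \<Longrightarrow> e \<subseteq> verts G \<and> card e = 2"
    and nonempty: "edges G \<noteq> {}" and J: "J = cover_ideal G"
    and h: "fps_of_poly h * (1 - fps_X) ^ 2 = 1 - independence_form G fps_X (1 - fps_X)"
  shows "quotient_h_polynomial (verts G) J = h"
proof -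
  let ?V = "verts G"
  let ?H = "hilbert_series (poly_ring ?V Quot J) ((\<lambda>p. J +>\<^bsub>poly_ring ?V\<^esub> p) ` constants)
      (\<lambda>i. (\<lambda>p. J +>\<^bsub>poly_ring ?V\<^esub> p) ` homogeneous ?V i)"
  let ?t = "\<lambda>F. fps_X ^ card F * (1 - fps_X) ^ (card ?V - card F) :: int fps"
  have not_cover: "\<not> vertex_cover G {}"
    using nonempty by (auto simp: vertex_cover_def)
  obtain e where "e \<in> edges G" using nonempty by blast
  then have "card ?V \<ge> 2"
    using edge[of e] fin card_mono by metis
  then have "card ?V = (card ?V - 2) + 2" by simp
  then have power_card: "(1 - fps_X :: int fps) ^ card ?V = (1 - fps_X) ^ (card ?V - 2) * (1 - fps_X) ^ 2"
    by (metis power_add)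
  have "?H * (1 - fps_X) ^ card ?V = (\<Sum>F | F \<subseteq> ?V \<and> \<not> vertex_cover G F. ?t F)"
    by (rule hilbert_series_quotient_mono_ideal[OF fin up_closed_vertex_cover not_cover])
      (simp add: J cover_ideal_eq_mono_ideal[OF fin])
  also have "{F. F \<subseteq> ?V \<and> \<not> vertex_cover G F} = Pow ?V - {F. vertex_cover G F}"
    by auto
  also have "sum ?t \<dots> = sum ?t (Pow ?V) - sum ?t {F. vertex_cover G F}"
    using fin by (intro sum_diff) (auto simp: vertex_cover_def)
  also have "sum ?t (Pow ?V) = 1"
    using sum_Pow_binomial[OF fin, of "card ?V" 0 "1 - fps_X" "fps_X :: int fps"]
    by (simp add: mult.commute)
  also have "sum ?t {F. vertex_cover G F} = independence_form G fps_X (1 - fps_X)"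
    using edge by (intro sum_vertex_covers[OF fin]) blast
  finally have "?H * (1 - fps_X) ^ (card ?V - 2) * (1 - fps_X) ^ 2 = fps_of_poly h * (1 - fps_X) ^ 2"
    unfolding h by (simp only: power_card mult.assoc)
  moreover have "(1 - fps_X :: int fps) ^ 2 \<noteq> 0"
    by simp
  ultimately have H: "?H * (1 - fps_X) ^ (card ?V - 2) = fps_of_poly h"
    using mult_right_cancel by blast
  have "krull_dim (poly_ring ?V Quot J) = enat (card ?V - 2)"
    unfolding J using fin edge nonempty by (rule krull_dim_cover_ideal)
  then have dim: "the_enat (krull_dim (poly_ring ?V Quot J)) = card ?V - 2"
    by simp
  show ?thesis
    unfolding quotient_h_polynomial_def h_polynomial_def dim H
    by (simp add: fps_of_poly_eq_iff)
qed

section \<open>The graphs of the theorem\<close>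

lemma finite_verts_G_graph: "finite (verts (G_graph k r))"
  by (simp add: G_graph_def cone_def disjoint_union_def B_graph_def star_def)

lemma edges_B_graph:
  assumes "e \<in> edges (B_graph k)"
  shows "e \<subseteq> verts (B_graph k) \<and> card e = 2"
proof -
  consider i j where "e = {CV i, CV j}" "i \<in> {1..k + 1}" "j \<in> {1..k + 1}" "i \<noteq> j"
    | i j where "e = {ZV j, CV i}" "j \<in> {1..k - 1}" "i \<in> {1..j}"
    using assms unfolding B_graph_def sgraph.simps by blast
  then show ?thesis
    by cases (auto simp: B_graph_def)
qed

lemma edges_star:
  assumes "e \<in> edges (star r)"
  shows "e \<subseteq> verts (star r) \<and> card e = 2"
  using assms by (auto simp: star_def)

lemma edges_disjoint_union:
  assumes G: "\<And>e. e \<in> edges G \<Longrightarrow> e \<subseteq> verts G \<and> card e = 2"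
    and H: "\<And>e. e \<in> edges H \<Longrightarrow> e \<subseteq> verts H \<and> card e = 2"
    and e: "e \<in> edges (disjoint_union G H)"
  shows "e \<subseteq> verts (disjoint_union G H) \<and> card e = 2"
proof -
  from e consider e' where "e = Inl ` e'" "e' \<in> edges G" | e' where "e = Inr ` e'" "e' \<in> edges H"
    unfolding disjoint_union_def sgraph.simps by blast
  then show ?thesis
  proof cases
    case 1
    then show ?thesis
      using G[of e'] by (auto simp: disjoint_union_def card_image)
  next
    case 2
    then show ?thesis
      using H[of e'] by (auto simp: disjoint_union_def card_image)
  qed
qed

lemma edges_cone:
  assumes G: "\<And>e. e \<in> edges G \<Longrightarrow> e \<subseteq> verts G \<and> card e = 2"
    and e: "e \<in> edges (cone G)"
  shows "e \<subseteq> verts (cone G) \<and> card e = 2"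
proof -
  from e consider e' where "e = Some ` e'" "e' \<in> edges G" | v where "e = {None, Some v}" "v \<in> verts G"
    unfolding cone_def sgraph.simps by blast
  then show ?thesis
  proof cases
    case 1
    then show ?thesis
      using G[of e'] by (auto simp: cone_def card_image)
  qed (auto simp: cone_def)
qed

lemma independence_form_G_graph:
  fixes a :: "'a::comm_ring_1"
  assumes k: "k \<ge> 1"
  shows "independence_form (G_graph k r) a (1 - a) =
    2 * a ^ (k + 2) - a ^ (2 * k + 2) + 2 * a ^ (k + r + 1) - 2 * a ^ (k + r + 2)"
proof -
  let ?D = "disjoint_union (B_graph k) (star r)"
  have fin: "finite (verts (B_graph k))" "finite (verts (star r))" "finite (verts ?D)"
    by (simp_all add: disjoint_union_def B_graph_def star_def)
  have nonempty_edges: "{} \<notin> edges ?D"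
    using edges_disjoint_union[OF edges_B_graph edges_star] by fastforce
  have card_D: "card (verts ?D) = 2 * k + r + 1"
    using card_verts_G_graph[OF k, of r] fin(3)
    by (simp add: G_graph_def cone_def card_image)
  have "independence_form (G_graph k r) a (1 - a) =
      a * ((2 * a ^ k - a ^ (2 * k)) * (a * (a + (1 - a)) ^ r + (1 - a) * a ^ r)) +
      (1 - a) * a ^ (2 * k + r + 1)"
    unfolding G_graph_def
    by (simp only: independence_form_cone[OF fin(3) nonempty_edges] card_D independence_form_disjoint_union[OF fin(1,2)]
        independence_form_B_graph[OF k] independence_form_star)
  also have "\<dots> = 2 * a ^ (k + 2) - a ^ (2 * k + 2) + 2 * a ^ (k + r + 1) - 2 * a ^ (k + r + 2)"
    by (simp add: algebra_simps power_add power2_eq_square)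
  finally show ?thesis .
qed

text \<open>
  This is \<open>(1 - I(t, 1 - t)) / (1 - t)\<^sup>2\<close>, obtained by regrouping the numerator as
  \<open>(1 - t\<^bsup>k+1\<^esup>)\<^sup>2 + 2 t\<^bsup>k+1\<^esup> (1 - t) (1 - t\<^bsup>r\<^esup>)\<close>.
\<close>

definition h_poly :: "nat \<Rightarrow> nat \<Rightarrow> int poly" where
  "h_poly k r = (\<Sum>i<k + 1. Polynomial.monom 1 i) ^ 2 + Polynomial.monom 2 (k + 1) * (\<Sum>i<r. Polynomial.monom 1 i)"

lemma fps_h_poly:
  assumes "k \<ge> 1"
  shows "fps_of_poly (h_poly k r) * (1 - fps_X) ^ 2 =
    1 - independence_form (G_graph k r) fps_X (1 - fps_X)"
proof -
  have geo: "fps_of_poly (\<Sum>i<n. Polynomial.monom 1 i) * (1 - fps_X) = (1 - fps_X ^ n :: int fps)" for n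
    by (simp add: fps_of_poly_sum fps_of_poly_monom' one_diff_power_eq mult.commute)
  have mon: "fps_of_poly (Polynomial.monom 2 (k + 1)) = (2 * fps_X ^ (k + 1) :: int fps)"
    by (simp add: fps_of_poly_monom fps_numeral_simps flip: fps_numeral_fps_const)
  have "fps_of_poly (h_poly k r) * (1 - fps_X) ^ 2 =
      (fps_of_poly (\<Sum>i<k + 1. Polynomial.monom 1 i) * (1 - fps_X)) ^ 2 +
      2 * fps_X ^ (k + 1) * (1 - fps_X) * (fps_of_poly (\<Sum>i<r. Polynomial.monom 1 i) * (1 - fps_X))"
    unfolding h_poly_def fps_of_poly_add fps_of_poly_mult fps_of_poly_power mon
    by (simp only: distrib_left distrib_right power_mult_distrib power2_eq_square[of "1 - fps_X"] mult_ac)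
  also have "\<dots> = (1 - fps_X ^ (k + 1)) ^ 2 + 2 * fps_X ^ (k + 1) * (1 - fps_X) * (1 - fps_X ^ r)"
    unfolding geo ..
  also have "\<dots> = 1 - independence_form (G_graph k r) fps_X (1 - fps_X)"
  proof -
    define x y z :: "int fps" where "x = fps_X" and "y = fps_X ^ k" and "z = fps_X ^ r"
    have powers: "fps_X ^ (k + 1) = y * x" "fps_X ^ (k + 2) = y * x * x" "fps_X ^ (2 * k + 2) = y * y * x * x"
      "fps_X ^ (k + r + 1) = y * z * x" "fps_X ^ (k + r + 2) = y * z * x * x"
      by (simp_all only: x_def y_def z_def power_add power2_eq_square power_one_right mult_2 mult_2_right mult_ac)
    show ?thesis
      unfolding independence_form_G_graph[OF assms] powers
      unfolding z_def[symmetric]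
      unfolding x_def[symmetric]
      by (simp add: algebra_simps power2_eq_square)
  qed
  finally show ?thesis .
qed

text \<open>
  The square has degree \<open>2 k \<le> k + r\<close> and the second summand has degree \<open>k + r\<close>; no cancellation can
  occur when \<open>k = r\<close>, because all coefficients are nonnegative.
\<close>

lemma degree_h_poly:
  assumes "k \<le> r" "r \<ge> 1"
  shows "Polynomial.degree (h_poly k r) = k + r"
proof -
  define g where "g n = (\<Sum>i<n. Polynomial.monom 1 i :: int poly)" for n
  have coeff_g: "Polynomial.coeff (g n) j = (if j < n then 1 else 0)" for n j
    by (simp add: g_def Polynomial.coeff_sum)
  have coeff_h: "Polynomial.coeff (h_poly k r) j =
      (\<Sum>i\<le>j. Polynomial.coeff (g (k + 1)) i * Polynomial.coeff (g (k + 1)) (j - i)) +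
      (if k + 1 \<le> j then 2 * Polynomial.coeff (g r) (j - (k + 1)) else 0)" for j
    unfolding h_poly_def g_def[symmetric] power2_eq_square Polynomial.coeff_add
      Polynomial.coeff_mult[of "g (k + 1)" "g (k + 1)"] Polynomial.coeff_monom_mult
    by simp
  have "Polynomial.coeff (h_poly k r) j = 0" if "k + r < j" for j
  proof -
    have "Polynomial.coeff (g (k + 1)) i * Polynomial.coeff (g (k + 1)) (j - i) = 0" for i
    proof -
      have "\<not> (i < k + 1 \<and> j - i < k + 1)"
        using assms that by linarith
      then show ?thesis
        by (auto simp: coeff_g)
    qed
    then have "(\<Sum>i\<le>j. Polynomial.coeff (g (k + 1)) i * Polynomial.coeff (g (k + 1)) (j - i)) = 0"
      by (intro sum.neutral) blast
    moreover have "\<not> j - (k + 1) < r"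
      using that by linarith
    then have "Polynomial.coeff (g r) (j - (k + 1)) = 0"
      by (simp add: coeff_g)
    ultimately show ?thesis
      unfolding coeff_h by simp
  qed
  then have "Polynomial.degree (h_poly k r) \<le> k + r"
    by (intro Polynomial.degree_le) auto
  moreover have "(\<Sum>i\<le>k + r. Polynomial.coeff (g (k + 1)) i * Polynomial.coeff (g (k + 1)) (k + r - i)) \<ge> 0"
    by (intro sum_nonneg) (simp add: coeff_g)
  then have "Polynomial.coeff (h_poly k r) (k + r) > 0"
    unfolding coeff_h using assms(2) by (simp add: coeff_g)
  then have "k + r \<le> Polynomial.degree (h_poly k r)"
    by (intro Polynomial.le_degree) simp
  ultimately show ?thesis by simp
qed

theorem lemma9p6:
  fixes k r n :: nat
    and J :: "(((B_vertex + star_vertex) option \<Rightarrow>\<^sub>0 nat) \<Rightarrow>\<^sub>0 'k::field) set"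
  assumes "k \<ge> 1" and "r \<ge> k"
    and "n = card (verts (G_graph k r))"
    and "J = cover_ideal (G_graph k r)"
  shows "int n - 3 \<ge> int (Polynomial.degree (quotient_h_polynomial (verts (G_graph k r)) J))
       \<and> int (Polynomial.degree (quotient_h_polynomial (verts (G_graph k r)) J))
           \<ge> \<lceil>2 * (real n - 2) / 3\<rceil>"
proof -
  have edge: "e \<subseteq> verts (G_graph k r) \<and> card e = 2" if "e \<in> edges (G_graph k r)" for e
    using that unfolding G_graph_def
    by (intro edges_cone edges_disjoint_union[OF edges_B_graph edges_star])
  have "{None, Some (Inr Centre)} \<in> edges (G_graph k r)"
    by (auto simp: G_graph_def cone_def disjoint_union_def star_def)
  then have nonempty: "edges (G_graph k r) \<noteq> {}" by blast
  have "quotient_h_polynomial (verts (G_graph k r)) J = h_poly k r"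
    using finite_verts_G_graph edge nonempty assms(4) fps_h_poly[OF assms(1)]
    by (rule quotient_h_polynomial_cover_ideal)
  then have deg: "Polynomial.degree (quotient_h_polynomial (verts (G_graph k r)) J) = k + r"
    using degree_h_poly[of k r] assms(1,2) by simp
  have n: "n = 2 * k + r + 2"
    using card_verts_G_graph[OF assms(1)] assms(3) by simp
  have "\<lceil>2 * (real n - 2) / 3\<rceil> \<le> int (k + r)"
    unfolding ceiling_le_iff using assms(2) by (simp add: n)
  moreover have "int n - 3 \<ge> int (k + r)"
    using assms(1) by (simp add: n)
  ultimately show ?thesis
    unfolding deg by blast
qed

end
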